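(* (i) Let $S\equiv\pm\{1, 3, 4, 5, 7, 9, 11, 16, 17, 18, 19, 20\}\pmod{42}$ and $T\equiv\pm\{1, 2, 3, 7, 8, 11, 13, 15, 17, 18, 19, 20\}\pmod{42}$. Then $p(S,n)=p(T,n-1)$ for all $n\geq 1$. (ii) Let $S\equiv\pm\{1, 2, 5, 6, 7, 9, 10, 11, 13, 15, 16, 19\}\pmod{42}$ and $T\equiv\pm\{1, 3, 4, 5, 6, 7, 11, 13, 15, 16, 17, 20\}\pmod{42}$. Then $p(S,n)=p(T,n)$ for all integers $n\ge0$ with $n\neq 2$. (iii) Let $S\equiv\pm\{1, 3, 4, 5, 7, 9, 10, 11, 12, 17, 19, 20\}\pmod{42}$ and $T\equiv\pm\{1, 2, 5, 7, 8, 9, 10, 11, 12, 13, 15, 19\}\pmod{42}$. Then $p(S,n)=p(T,n)$ for all integers $n\ge0$ with $n\neq 2$. (iv) Let $S\equiv\pm\{2, 3, 5, 7, 8, 9, 10, 11, 13, 17, 18, 19\}\pmod{42}$ and $T\equiv\pm\{1, 3, 5, 7, 8, 11, 13, 15, 16, 17, 18, 20\}\pmod{42}$. Then $p(S,n)=p(T,n-2)$ for all $n\geq 2$. (v) Let $S\equiv\pm\{3, 4, 5, 7, 8, 9, 10, 11, 12, 13, 17, 19\}\pmod{42}$ and $T\equiv\pm\{1, 4, 5, 7, 9, 12, 13, 15, 16, 17, 19, 20\}\pmod{42}$. Then $p(S,n)=p(T,n-3)$ for all $n\geq 3$. (vi) Let $S\equiv\pm\{1, 2, 4, 5, 6, 7,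 9, 13, 15, 16, 17, 19\}\pmod{42}$ and $T\equiv\pm\{1, 2, 3, 6, 7, 8, 10, 11, 13, 15, 17, 19\}\pmod{42}$. Then $p(S,n)=p(T,n)$ for all integers $n\ge0$ with $n\neq 3$.
   Context: For a set $S$ of positive integers and an integer $n\ge 0$, $p(S,n)$ denotes the number of partitions of $n$ into parts belonging to $S$ (so $p(S,0)=1$). The notation $S\equiv\pm\{r_1,\dots,r_k\}\pmod M$ means that $S$ is the set of all positive integers $n$ such that $n\equiv r_i$ or $n\equiv -r_i\pmod M$ for some $i$. *)

theory Defs
  imports "HOL-Library.Multiset" "HOL-Number_Theory.Cong"
begin

text \<open>
  A partition of \<open>n\<close> into parts from \<open>S\<close> is a finite multiset of elements of \<open>S\<close> with sum \<open>n\<close>.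
  The definition is meant for sets \<open>S\<close> of positive integers, for which there are only finitely
  many such multisets.
\<close>

definition partitions_into :: "nat set \<Rightarrow> nat \<Rightarrow> nat multiset set" where
  "partitions_into S n = {P. set_mset P \<subseteq> S \<and> sum_mset P = n}"

definition partition_count :: "nat set \<Rightarrow> nat \<Rightarrow> nat" where
  "partition_count S n = card (partitions_into S n)"

definition pm_residues :: "int set \<Rightarrow> int \<Rightarrow> nat set" where
  "pm_residues R M = {n. n > 0 \<and> (\<exists>r\<in>R. [int n = r] (mod M) \<or> [int n = - r] (mod M))}"

end

theory Submission
  imports Defs "HOL-Analysis.Analysis"
begin

text \<open>
  For \<open>0 < q < 1\<close> put \<open>T\<^sub>r = \<Prod>\<^bsub>n\<ge>0\<^esub> (1 - q\<^bsup>42n+r\<^esup>) (1 - q\<^bsup>42n+42-r\<^esup>)\<close>. In terms of generating functions,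
  part (i) reads
  \<open>T\<^sub>2 T\<^sub>8 T\<^sub>1\<^sub>3 T\<^sub>1\<^sub>5 - q T\<^sub>4 T\<^sub>5 T\<^sub>9 T\<^sub>1\<^sub>6 = \<Prod> T\<^sub>r\<close> with \<open>r\<close> ranging over \<open>{1..20} - {6, 10, 12, 14}\<close>.
  Multiplying the indices by a unit \<open>m\<close> modulo 42 permutes the six parts
  (\<open>m = 1, 5, 11, 13, 17, 19\<close>), so it suffices to prove one identity for suitably normalised theta
  functions, which are odd and antiperiodic in \<open>r\<close>, evaluated at the multiples of \<open>m\<close>.

  This identity is a combination of three instances of the Weierstrass three-term relation: two in
  base \<open>q\<^bsup>42\<^esup>\<close>, and one in base \<open>q\<^bsup>21\<^esup>\<close> with some arguments negated. Writing
  \<open>[x; q] = \<Prod>\<^bsub>n\<ge>0\<^esub> (1 - x q\<^sup>n) (1 - q\<^bsup>n+1\<^esup> / x)\<close>, the two bases are linked by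
  \<open>[x; q\<^sup>2] [q x; q\<^sup>2] = [x; q]\<close> and \<open>[x; q] [-x; q] = [x\<^sup>2; q\<^sup>2]\<close>. The three-term relation is a Pluecker
  relation: by the Jacobi triple product, \<open>[x y; q] [x / y; q]\<close> is a 2 by 2 determinant
  \<open>x (P(x) Q(y) - P(y) Q(x))\<close> up to a constant.
\<close>

subsection \<open>The Jacobi triple product\<close>

definition qpoch :: "real \<Rightarrow> nat \<Rightarrow> real" where
  "qpoch q n = (\<Prod>k<n. 1 - q ^ Suc k)"

text \<open>The value 0 for \<open>j > m\<close> lets the q-Pascal rule hold at \<open>j = m\<close>
  as well.\<close>

definition gauss_binomial :: "real \<Rightarrow> nat \<Rightarrow> nat \<Rightarrow> real" where
  "gauss_binomial q m j = (if j \<le> m then qpoch q m / (qpoch q j * qpoch q (m - j)) else 0)"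

definition theta_prod :: "real \<Rightarrow> real \<Rightarrow> real" where
  "theta_prod q x = (\<Prod>n. (1 - x * q ^ n) * (1 - q ^ Suc n / x))"

lemma qpoch_0 [simp]: "qpoch q 0 = 1"
  by (simp add: qpoch_def)

lemma qpoch_Suc: "qpoch q (Suc n) = qpoch q n * (1 - q ^ Suc n)"
  by (simp add: qpoch_def)

lemma qpoch_pos: "0 < q \<Longrightarrow> q < 1 \<Longrightarrow> qpoch q n > 0"
  unfolding qpoch_def by (intro prod_pos) (auto simp: power_Suc_less_one simp del: power_Suc)

lemma gauss_binomial_0 [simp]: "0 < q \<Longrightarrow> q < 1 \<Longrightarrow> gauss_binomial q m 0 = 1"
  using qpoch_pos[of q m] by (simp add: gauss_binomial_def)

lemma gauss_binomial_eq_0 [simp]: "m < j \<Longrightarrow> gauss_binomial q m j = 0"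
  by (simp add: gauss_binomial_def)

text \<open>The q-Pascal rule. The last factor of the numerator splits as
  \<open>1 - q^(m+1) = (1 - q^(m-j)) + q^(m-j) * (1 - q^(j+1))\<close>, and each summand cancels one
  factor of the denominator.\<close>

lemma gauss_binomial_Suc_Suc:
  assumes q: "0 < q" "q < 1" and "j \<le> m"
  shows "gauss_binomial q (Suc m) (Suc j) =
    gauss_binomial q m (Suc j) + q ^ (m - j) * gauss_binomial q m j"
proof (cases "j = m")
  case True
  then show ?thesis
    using qpoch_pos[OF q, of "Suc m"] qpoch_pos[OF q, of m] by (simp add: gauss_binomial_def)
next
  case False
  with \<open>j \<le> m\<close> obtain d where m: "m = Suc (j + d)"
    by (metis le_neq_implies_less less_imp_Suc_add)
  have nz: "qpoch q i \<noteq> 0" "1 - q ^ Suc i \<noteq> 0" for i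
    using qpoch_pos[OF q, of i] power_Suc_less_one[of q i] q by (auto simp del: power_Suc)
  have eq: "1 - q ^ Suc m = (1 - q ^ Suc d) + q ^ Suc d * (1 - q ^ Suc j)"
    by (simp add: m algebra_simps power_add)
  have "gauss_binomial q (Suc m) (Suc j) =
      qpoch q m * (1 - q ^ Suc m) / (qpoch q (Suc j) * qpoch q (Suc d))"
    by (simp add: gauss_binomial_def m qpoch_Suc[of q "Suc (j + d)"] del: power_Suc)
  also have "\<dots> = qpoch q m * (1 - q ^ Suc d) / (qpoch q (Suc j) * qpoch q (Suc d)) +
      q ^ Suc d * (qpoch q m * (1 - q ^ Suc j) / (qpoch q (Suc j) * qpoch q (Suc d)))"
    unfolding eq by (simp add: add_divide_distrib distrib_left del: power_Suc)
  also have "qpoch q m * (1 - q ^ Suc d) / (qpoch q (Suc j) * qpoch q (Suc d)) =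
      qpoch q m / (qpoch q (Suc j) * qpoch q d)"
    using nz[of d] by (simp add: qpoch_Suc[of q d] del: power_Suc)
  also have "qpoch q m * (1 - q ^ Suc j) / (qpoch q (Suc j) * qpoch q (Suc d)) =
      qpoch q m / (qpoch q j * qpoch q (Suc d))"
    using nz[of j] by (simp add: qpoch_Suc[of q j] del: power_Suc)
  finally show ?thesis
    by (simp add: gauss_binomial_def m Suc_diff_le)
qed

text \<open>Induction on the number of factors: the q-Pascal rule splits each coefficient, and the
  part of the new factor \<open>1 + z * q ^ m\<close> containing \<open>z\<close> shifts the index
  by one.\<close>

lemma q_binomial_theorem:
  assumes q: "0 < q" "q < 1"
  shows "(\<Prod>k<m. 1 + z * q ^ k) = (\<Sum>j\<le>m. gauss_binomial q m j * q ^ (j choose 2) * z ^ j)"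
proof (induction m)
  case 0
  then show ?case using q by (simp add: numeral_2_eq_2)
next
  case (Suc m)
  let ?t = "\<lambda>m j. gauss_binomial q m j * q ^ (j choose 2) * z ^ j"
  have step: "?t (Suc m) (Suc j) = ?t m (Suc j) + z * q ^ m * ?t m j" if "j \<le> m" for j
  proof -
    have "q ^ (m - j) * q ^ (Suc j choose 2) = q ^ m * q ^ (j choose 2)"
      using that by (simp add: numeral_2_eq_2 flip: power_add)
    then show ?thesis
      unfolding gauss_binomial_Suc_Suc[OF q that] by (simp add: algebra_simps)
  qed
  have "(\<Sum>j\<le>Suc m. ?t (Suc m) j) = 1 + (\<Sum>j\<le>m. ?t (Suc m) (Suc j))"
    using q by (subst sum.atMost_Suc_shift) (simp add: numeral_2_eq_2)
  also have "\<dots> = (1 + (\<Sum>j\<le>m. ?t m (Suc j))) + z * q ^ m * (\<Sum>j\<le>m. ?t m j)"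
    using step by (simp add: sum.distrib sum_distrib_left)
  also have "1 + (\<Sum>j\<le>m. ?t m (Suc j)) = (\<Sum>j\<le>Suc m. ?t m j)"
    using q by (subst sum.atMost_Suc_shift) (simp add: numeral_2_eq_2)
  also have "\<dots> = (\<Sum>j\<le>m. ?t m j)"
    by simp
  finally show ?case
    using Suc.IH by (simp add: algebra_simps)
qed

text \<open>The q-binomial theorem with \<open>2 * N\<close> factors at
  \<open>z = - x / q ^ N\<close>, its sum re-centred by \<open>j = N + n\<close>. The factors with
  \<open>k \<ge> N\<close> become \<open>1 - x * q ^ k\<close>; the others, read backwards, become
  \<open>1 - q ^ Suc k / x\<close> up to monomials whose product is \<open>C\<close>.\<close>

lemma finite_jacobi_triple_product:
  assumes q: "0 < q" "q < 1" and x: "x \<noteq> 0"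
  shows "(\<Prod>k<N. (1 - x * q ^ k) * (1 - q ^ Suc k / x)) =
    (\<Sum>n = - int N..int N. gauss_binomial q (2 * N) (nat (int N + n)) *
       ((- x) powi n * q powr (n * (n - 1) / 2)))"
proof -
  define z where "z = - x / q ^ N"
  define C where "C = (\<Prod>k<N. - x / q ^ Suc k)"
  have "(\<Prod>k<N. q ^ Suc k) = q powr (N * (N + 1) / 2)"
    by (induction N) (use q in \<open>auto simp: powr_realpow[symmetric] powr_add[symmetric] field_simps simp del: power_Suc\<close>)
  then have C: "C = (- x) ^ N / q powr (N * (N + 1) / 2)"
    unfolding C_def prod_dividef by (simp del: power_Suc)
  have C0: "C \<noteq> 0"
    using x q by (simp add: C)
  have "(\<Prod>k<N. 1 + z * q ^ k) = (\<Prod>k<N. 1 + z * q ^ (N - Suc k))"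
    by (rule prod.nat_diff_reindex[symmetric])
  also have "\<dots> = (\<Prod>k<N. (- x / q ^ Suc k) * (1 - q ^ Suc k / x))"
  proof (rule prod.cong)
    fix k assume "k \<in> {..<N}"
    then have "q ^ N = q ^ (N - Suc k) * q ^ Suc k"
      by (simp flip: power_add del: power_Suc)
    then show "1 + z * q ^ (N - Suc k) = (- x / q ^ Suc k) * (1 - q ^ Suc k / x)"
      using q x by (simp add: z_def field_simps del: power_Suc)
  qed simp
  finally have low: "(\<Prod>k<N. 1 + z * q ^ k) = C * (\<Prod>k<N. 1 - q ^ Suc k / x)"
    by (simp only: C_def prod.distrib)
  have "{..<2 * N} = {..<N} \<union> (\<lambda>k. N + k) ` {..<N}"
  proof (intro equalityI subsetI)
    fix k assume "k \<in> {..<2 * N}"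
    then show "k \<in> {..<N} \<union> (\<lambda>k. N + k) ` {..<N}"
      by (cases "k < N") (auto intro!: image_eqI[of _ _ "k - N"])
  qed auto
  then have "(\<Prod>k<2 * N. 1 + z * q ^ k) = (\<Prod>k<N. 1 + z * q ^ k) * (\<Prod>k\<in>(\<lambda>k. N + k) ` {..<N}. 1 + z * q ^ k)"
    by (simp only:) (subst prod.union_disjoint, auto)
  also have "(\<Prod>k\<in>(\<lambda>k. N + k) ` {..<N}. 1 + z * q ^ k) = (\<Prod>k<N. 1 - x * q ^ k)"
    using q by (subst prod.reindex) (auto simp: inj_on_def z_def power_add)
  finally have "C * (\<Prod>k<N. (1 - x * q ^ k) * (1 - q ^ Suc k / x)) = (\<Prod>k<2 * N. 1 + z * q ^ k)"
    unfolding low prod.distrib by (simp only: mult_ac)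
  also have "\<dots> = (\<Sum>j\<le>2 * N. gauss_binomial q (2 * N) j * q ^ (j choose 2) * z ^ j)"
    by (rule q_binomial_theorem[OF q])
  also have "\<dots> = (\<Sum>n = - int N..int N. gauss_binomial q (2 * N) (nat (int N + n)) *
      q ^ (nat (int N + n) choose 2) * z ^ nat (int N + n))"
    by (rule sum.reindex_bij_witness[of _ "\<lambda>n. nat (int N + n)" "\<lambda>j. int j - int N"]) auto
  also have "\<dots> = (\<Sum>n = - int N..int N. C * (gauss_binomial q (2 * N) (nat (int N + n)) *
       ((- x) powi n * q powr (n * (n - 1) / 2))))"
  proof (rule sum.cong)
    fix n assume n: "n \<in> {- int N..int N}"
    define j where "j = nat (int N + n)"
    have jn: "int j = int N + n"
      using n by (simp add: j_def)
    then have jr: "real j = real N + real_of_int n"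
      by (metis of_int_add of_int_of_nat_eq)
    have "even (j * (j - 1))" by (cases "even j") auto
    then have "real (j choose 2) = real j * (real j - 1) / 2"
      by (cases j) (auto simp: choose_two real_of_nat_div algebra_simps)
    then have 1: "q ^ (j choose 2) = q powr (real j * (real j - 1) / 2)"
      using q by (simp only: powr_realpow[symmetric])
    have 2: "z ^ j = (- x) ^ j / q powr (real N * real j)"
      unfolding z_def power_divide power_mult[symmetric] of_nat_mult[symmetric] powr_realpow[OF q(1)] ..
    have 3: "(- x) ^ j = (- x) ^ N * (- x) powi n"
      using x by (simp add: jn power_int_add flip: power_int_of_nat)
    \<comment> \<open>This is \<open>j(j-1)/2 + N(N+1)/2 = N j + n(n-1)/2\<close> for
      \<open>j = N + n\<close>. Apart from the common constant \<open>C\<close>, the monomial then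
      depends on \<open>n\<close> alone.\<close>
    have "q powr (real j * (real j - 1) / 2) * q powr (N * (N + 1) / 2) =
        q powr (real N * real j) * q powr (n * (n - 1) / 2)"
      unfolding powr_add[symmetric] jr by (rule arg_cong) (simp add: field_simps)
    then have "q ^ (j choose 2) * z ^ j = C * ((- x) powi n * q powr (n * (n - 1) / 2))"
      using q unfolding 1 2 3 C by (simp add: field_simps)
    then show "gauss_binomial q (2 * N) (nat (int N + n)) * q ^ (nat (int N + n) choose 2) * z ^ nat (int N + n) =
      C * (gauss_binomial q (2 * N) (nat (int N + n)) * ((- x) powi n * q powr (n * (n - 1) / 2)))"
      unfolding j_def[symmetric] by (simp add: algebra_simps)
  qed simp
  finally show ?thesis
    using C0 by (simp flip: sum_distrib_left)
qed

section \<open>The theta series and its absolute convergence\<close>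

definition theta_term :: "real \<Rightarrow> real \<Rightarrow> int \<Rightarrow> real" where
  "theta_term q x n = (- x) powi n * q powr (n * (n - 1) / 2)"

definition qpoch_inf :: "real \<Rightarrow> real" where
  "qpoch_inf q = (\<Prod>k. 1 - q ^ Suc k)"

lemma convergent_prod_one_minus_geometric:
  assumes "0 < q" "q < (1::real)"
  shows "convergent_prod (\<lambda>n. 1 - c * q ^ n)"
proof -
  have "summable (\<lambda>n. \<bar>c\<bar> * q ^ n)"
    using assms by (intro summable_mult summable_geometric) auto
  then have "summable (\<lambda>n. norm ((1 - c * q ^ n) - 1))"
    using assms by (simp add: abs_mult)
  then show ?thesis
    by (intro abs_convergent_prod_imp_convergent_prod summable_imp_abs_convergent_prod)
qed

lemma convergent_prod_qpoch: "0 < q \<Longrightarrow> q < (1::real) \<Longrightarrow> convergent_prod (\<lambda>k. 1 - q ^ Suc k)"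
  using convergent_prod_one_minus_geometric[of q q] by simp

lemma qpoch_tendsto:
  assumes "0 < q" "q < 1"
  shows "qpoch q \<longlonglongrightarrow> qpoch_inf q"
  using has_prod_imp_tendsto'[OF convergent_prod_has_prod[OF convergent_prod_qpoch[OF assms]]]
  by (simp add: qpoch_def[abs_def] qpoch_inf_def)

lemma qpoch_inf_pos:
  assumes q: "0 < q" "q < 1"
  shows "qpoch_inf q > 0"
  unfolding qpoch_inf_def
  by (rule less_0_prodinf[OF convergent_prod_qpoch[OF q]])
     (use q power_Suc_less_one[of q] in \<open>simp del: power_Suc\<close>)

lemma qpoch_Suc_le: "0 < q \<Longrightarrow> q < 1 \<Longrightarrow> qpoch q (Suc n) \<le> qpoch q n"
  unfolding qpoch_Suc using qpoch_pos[of q n] by (intro mult_left_le) (auto simp del: power_Suc)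

lemma qpoch_inf_le:
  assumes q: "0 < q" "q < 1"
  shows "qpoch_inf q \<le> qpoch q n"
  using decseq_ge[OF decseq_SucI qpoch_tendsto] qpoch_Suc_le q by blast

lemma theta_prod_convergent:
  assumes "0 < q" "q < (1::real)"
  shows "convergent_prod (\<lambda>n. (1 - x * q ^ n) * (1 - q ^ Suc n / x))"
proof -
  have "convergent_prod (\<lambda>n. 1 - q ^ Suc n / x)"
    using convergent_prod_one_minus_geometric[OF assms, of "q / x"] by (simp add: field_simps)
  then show ?thesis
    using convergent_prod_one_minus_geometric[OF assms, of x] by (intro convergent_prod_mult)
qed

lemma theta_prod_tendsto:
  assumes "0 < q" "q < 1"
  shows "(\<lambda>N. \<Prod>k<N. (1 - x * q ^ k) * (1 - q ^ Suc k / x)) \<longlonglongrightarrow> theta_prod q x"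
  unfolding theta_prod_def
  by (rule has_prod_imp_tendsto'[OF convergent_prod_has_prod[OF theta_prod_convergent[OF assms]]])

text \<open>The ratio of consecutive terms is \<open>y * q ^ n\<close>, which tends to 0.\<close>

lemma summable_partial_theta:
  assumes q: "0 < q" "q < 1" and y: "y > 0"
  shows "summable (\<lambda>n. y ^ n * q powr (n * (real n - 1) / 2))" (is "summable ?f")
proof -
  have "(\<lambda>n. y * q ^ n) \<longlonglongrightarrow> y * 0"
    using q by (intro tendsto_mult tendsto_const LIMSEQ_realpow_zero) auto
  then have "eventually (\<lambda>n. y * q ^ n < 1 / 2) sequentially"
    by (rule order_tendstoD) simp
  then obtain N where N: "\<And>n. n \<ge> N \<Longrightarrow> y * q ^ n < 1 / 2"
    by (auto simp: eventually_sequentially)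
  have step: "?f (Suc n) = y * q ^ n * ?f n" for n
  proof -
    have "q powr (Suc n * (real (Suc n) - 1) / 2) = q ^ n * q powr (n * (real n - 1) / 2)"
      using q by (simp add: powr_realpow[symmetric] powr_add[symmetric] field_simps)
    then show ?thesis by simp
  qed
  show ?thesis
  proof (rule summable_ratio_test[of "1/2" N])
    fix n assume "N \<le> n"
    have pos: "?f n \<ge> 0" "?f (Suc n) \<ge> 0"
      using y by simp_all
    have "?f (Suc n) \<le> 1 / 2 * ?f n"
      unfolding step using N[OF \<open>N \<le> n\<close>] pos by (intro mult_right_mono) auto
    then show "norm (?f (Suc n)) \<le> 1 / 2 * norm (?f n)"
      using pos by simp
  qed simp
qed

text \<open>Absolute values of the terms form a theta series at a negative argument, which has no
  alternating signs.\<close>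

lemma abs_theta_term: "\<bar>theta_term q x n\<bar> = theta_term q (- \<bar>x\<bar>) n"
  by (simp add: theta_term_def abs_mult power_int_abs)

text \<open>The integers are covered by two half-lines, on each of which the absolute values form a
  partial theta series: with \<open>y = |x|\<close> for \<open>n \<ge> 0\<close> and with
  \<open>y = q / |x|\<close> for \<open>n \<le> 0\<close>.\<close>

lemma abs_summable_theta_term:
  assumes q: "0 < q" "q < 1" and x: "x \<noteq> 0"
  shows "(\<lambda>n. norm (theta_term q x n)) summable_on UNIV"
proof -
  let ?g = "theta_term q (- \<bar>x\<bar>)"
  have 1: "?g summable_on range int"
  proof -
    have "(\<lambda>n. ?g (int n)) summable_on UNIV"
      using summable_partial_theta[OF q, of "\<bar>x\<bar>"] x
      by (intro norm_summable_imp_summable_on) (simp add: theta_term_def)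
    then show ?thesis
      by (subst summable_on_reindex) (auto simp: o_def)
  qed
  have 2: "?g summable_on range (\<lambda>m. - int m)"
  proof -
    have "?g (- int m) = (q / \<bar>x\<bar>) ^ m * q powr (m * (real m - 1) / 2)" for m
    proof -
      have "?g (- int m) = \<bar>x\<bar> powi (- int m) * q powr (m + m * (real m - 1) / 2)"
        by (simp add: theta_term_def field_simps)
      also have "\<dots> = (q / \<bar>x\<bar>) ^ m * q powr (m * (real m - 1) / 2)"
        unfolding powr_add using q by (simp add: power_int_minus power_divide powr_realpow field_simps)
      finally show ?thesis .
    qed
    then have "(\<lambda>m. ?g (- int m)) summable_on UNIV"
      using summable_partial_theta[OF q, of "q / \<bar>x\<bar>"] x q
      by (intro norm_summable_imp_summable_on) simp
    then show ?thesis
      by (subst summable_on_reindex) (auto simp: o_def inj_on_def)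
  qed
  have "?g summable_on (range int \<union> range (\<lambda>m. - int m))"
    using 1 2 by (rule summable_on_union)
  also have "range int \<union> range (\<lambda>m. - int m) = UNIV"
    by (auto simp: image_iff) (metis int_cases2)
  finally show ?thesis
    by (simp add: abs_theta_term[symmetric])
qed

section \<open>Passage to the limit in the finite triple product\<close>

lemma gauss_binomial_nonneg: "0 < q \<Longrightarrow> q < 1 \<Longrightarrow> 0 \<le> gauss_binomial q m j"
  using qpoch_pos[of q] by (simp add: gauss_binomial_def less_imp_le)

text \<open>A bound uniform in \<open>m\<close> and \<open>j\<close>, which supplies the dominating
  series for the limit. As \<open>qpoch q\<close> decreases, the numerator is at most one factor of
  the denominator, and the other factor is at least \<open>qpoch_inf q\<close>.\<close>

lemma gauss_binomial_le:
  assumes q: "0 < q" "q < 1"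
  shows "gauss_binomial q m j \<le> 1 / qpoch_inf q"
proof -
  note pos = qpoch_pos[OF q] qpoch_inf_pos[OF q]
  show ?thesis
  proof (cases "j \<le> m")
    case True
    have "qpoch q m \<le> qpoch q j"
      using True
    proof (induction m rule: dec_induct)
      case (step n)
      then show ?case
        using qpoch_Suc_le[OF q, of n] by simp
    qed simp
    then have "gauss_binomial q m j \<le> qpoch q j / (qpoch q j * qpoch q (m - j))"
      using True divide_right_mono[OF _ less_imp_le[OF mult_pos_pos[OF pos(1) pos(1)]]]
      by (simp only: gauss_binomial_def if_True)
    also have "\<dots> = 1 / qpoch q (m - j)"
      using pos(1)[of j] by simp
    also have "\<dots> \<le> 1 / qpoch_inf q"
      using qpoch_inf_le[OF q] pos by (intro divide_left_mono) auto
    finally show ?thesis .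
  qed (use pos in simp)
qed

text \<open>For fixed \<open>n\<close> all three q-factorials tend to \<open>qpoch_inf q\<close>, so
  one copy stays in the denominator.\<close>

lemma central_gauss_binomial_tendsto:
  assumes q: "0 < q" "q < 1"
  shows "(\<lambda>N. gauss_binomial q (2 * N) (nat (int N + n))) \<longlonglongrightarrow> 1 / qpoch_inf q"
proof -
  have at_top: "filterlim (\<lambda>N. nat (int N + c)) at_top sequentially" for c
    unfolding filterlim_at_top
  proof
    fix Z show "eventually (\<lambda>N. Z \<le> nat (int N + c)) sequentially"
      using eventually_ge_at_top[of "nat (int Z + \<bar>c\<bar>)"] by eventually_elim auto
  qed
  have lim: "(\<lambda>N. qpoch q (nat (int N + c))) \<longlonglongrightarrow> qpoch_inf q" for c
    using filterlim_compose[OF qpoch_tendsto[OF q] at_top] .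
  have lim2: "(\<lambda>N. qpoch q (2 * N)) \<longlonglongrightarrow> qpoch_inf q"
    by (rule filterlim_compose[OF qpoch_tendsto[OF q]])
       (auto intro!: filterlim_subseq simp: strict_mono_def)
  have "(\<lambda>N. qpoch q (2 * N) / (qpoch q (nat (int N + n)) * qpoch q (nat (int N + (- n)))))
      \<longlonglongrightarrow> qpoch_inf q / (qpoch_inf q * qpoch_inf q)"
    using qpoch_inf_pos[OF q] by (intro tendsto_intros lim lim2) auto
  moreover have "eventually (\<lambda>N. qpoch q (2 * N) / (qpoch q (nat (int N + n)) * qpoch q (nat (int N + (- n)))) =
      gauss_binomial q (2 * N) (nat (int N + n))) sequentially"
    using eventually_ge_at_top[of "nat \<bar>n\<bar>"]
  proof eventually_elim
    case (elim N)
    then have "2 * N - nat (int N + n) = nat (int N + (- n))" "nat (int N + n) \<le> 2 * N"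
      by auto
    then show ?case
      by (simp add: gauss_binomial_def)
  qed
  ultimately show ?thesis
    using qpoch_inf_pos[OF q] by (simp add: tendsto_cong)
qed

text \<open>The finite identity passes to the limit term by term, by Tannery's theorem (dominated
  convergence for series).\<close>

theorem jacobi_triple_product:
  assumes q: "0 < q" "q < 1" and x: "x \<noteq> 0"
  shows "(theta_term q x has_sum (qpoch_inf q * theta_prod q x)) UNIV"
proof -
  \<comment> \<open>Coefficients extended by zero outside \<open>{- int N..int N}\<close> turn each
    finite sum into a series over all integers. Listing the integers by \<open>int_decode\<close>
    gives the series over naturals that Tannery's theorem speaks of.\<close>
  define b where "b N n = (if n \<in> {- int N..int N} then gauss_binomial q (2 * N) (nat (int N + n)) else 0)" for N n
  define a where "a k N = b N (int_decode k) * theta_term q x (int_decode k)" for k N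
  let ?t = "\<lambda>k. theta_term q x (int_decode k)"
  note pos = qpoch_inf_pos[OF q]
  have sum_t: "summable (\<lambda>k. norm (?t k))"
  proof -
    have "(\<lambda>k. norm (?t k)) summable_on UNIV"
      using abs_summable_theta_term[OF q x] bij_int_decode
      by (subst summable_on_reindex_bij_betw[of int_decode UNIV UNIV]) auto
    then show ?thesis
      by (rule summable_on_imp_summable)
  qed
  have b_lim: "(\<lambda>N. b N n) \<longlonglongrightarrow> 1 / qpoch_inf q" for n
  proof (rule Lim_transform_eventually[OF central_gauss_binomial_tendsto[OF q, of n]])
    show "eventually (\<lambda>N. gauss_binomial q (2 * N) (nat (int N + n)) = b N n) sequentially"
      using eventually_ge_at_top[of "nat \<bar>n\<bar>"]
      by eventually_elim (auto simp: b_def)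
  qed
  have "eventually (\<lambda>N. summable (\<lambda>k. norm (a k N))) sequentially \<and>
      summable (\<lambda>k. norm (1 / qpoch_inf q * ?t k)) \<and>
      ((\<lambda>N. suminf (\<lambda>k. a k N)) \<longlonglongrightarrow> suminf (\<lambda>k. 1 / qpoch_inf q * ?t k))"
  proof (rule tannerys_theorem)
    show "(\<lambda>N. a k N) \<longlonglongrightarrow> 1 / qpoch_inf q * ?t k" for k
      unfolding a_def by (intro tendsto_intros b_lim)
    have "norm (a k N) \<le> 1 / qpoch_inf q * norm (?t k)" for k N
      unfolding a_def norm_mult using gauss_binomial_nonneg[OF q] gauss_binomial_le[OF q] pos
      by (intro mult_right_mono) (auto simp: b_def)
    then show "eventually (\<lambda>(k, N). norm (a k N) \<le> 1 / qpoch_inf q * norm (?t k)) (at_top \<times>\<^sub>F sequentially)"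
      by (simp add: case_prod_unfold)
    show "summable (\<lambda>k. 1 / qpoch_inf q * norm (?t k))"
      by (intro summable_mult sum_t)
  qed simp
  moreover have "suminf (\<lambda>k. a k N) = (\<Prod>k<N. (1 - x * q ^ k) * (1 - q ^ Suc k / x))" for N
  proof -
    have "suminf (\<lambda>k. a k N) = (\<Sum>k\<in>int_encode ` {- int N..int N}. a k N)"
    proof (rule suminf_finite)
      fix k assume "k \<notin> int_encode ` {- int N..int N}"
      then have "int_decode k \<notin> {- int N..int N}"
        by (metis imageI int_decode_inverse)
      then show "a k N = 0"
        unfolding a_def b_def by (simp only: if_False mult_zero_left)
    qed simp
    also have "\<dots> = (\<Sum>n = - int N..int N. b N n * theta_term q x n)"
      by (subst sum.reindex) (auto simp: a_def intro: inj_int_encode)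
    also have "\<dots> = (\<Prod>k<N. (1 - x * q ^ k) * (1 - q ^ Suc k / x))"
      unfolding finite_jacobi_triple_product[OF q x] by (intro sum.cong) (auto simp: b_def theta_term_def)
    finally show ?thesis .
  qed
  ultimately have "(\<lambda>N. \<Prod>k<N. (1 - x * q ^ k) * (1 - q ^ Suc k / x)) \<longlonglongrightarrow>
      suminf (\<lambda>k. 1 / qpoch_inf q * ?t k)"
    by simp
  from LIMSEQ_unique[OF this theta_prod_tendsto[OF q]]
  have "theta_prod q x = 1 / qpoch_inf q * suminf ?t"
    using suminf_mult[OF summable_norm_cancel[OF sum_t], of "1 / qpoch_inf q"] by simp
  then have "suminf ?t = qpoch_inf q * theta_prod q x"
    using pos by (simp add: field_simps)
  then have "?t sums (qpoch_inf q * theta_prod q x)"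
    using summable_sums[OF summable_norm_cancel[OF sum_t]] by simp
  then have "(?t has_sum (qpoch_inf q * theta_prod q x)) UNIV"
    using sum_t by (intro norm_summable_imp_has_sum)
  then show ?thesis
    using has_sum_reindex_bij_betw[OF bij_int_decode] by blast
qed

subsection \<open>The Weierstrass three-term relation\<close>

text \<open>By the triple product this is the sum of the theta series, the form in which products of
  theta functions can be multiplied out.\<close>

definition theta_sum :: "real \<Rightarrow> real \<Rightarrow> real" where
  "theta_sum q x = qpoch_inf q * theta_prod q x"

lemma has_sum_theta_term:
  "0 < q \<Longrightarrow> q < 1 \<Longrightarrow> x \<noteq> 0 \<Longrightarrow> (theta_term q x has_sum theta_sum q x) UNIV"
  unfolding theta_sum_def by (rule jacobi_triple_product)

text \<open>Both series converge absolutely, so their product is an unordered double sum, which may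
  be regrouped and reindexed.\<close>

lemma has_sum_theta_product:
  assumes q: "0 < q" "q < 1" and r: "0 < r" "r < 1" and x: "x \<noteq> 0" and y: "y \<noteq> 0"
  shows "((\<lambda>(m, n). theta_term q x m * theta_term r y n) has_sum (theta_sum q x * theta_sum r y)) (UNIV \<times> UNIV)"
proof (rule has_sum_SigmaI)
  show "((\<lambda>n. case (m, n) of (m, n) \<Rightarrow> theta_term q x m * theta_term r y n) has_sum
      theta_term q x m * theta_sum r y) UNIV" for m
    using has_sum_cmult_right[OF has_sum_theta_term[OF r y]] by simp
  show "((\<lambda>m. theta_term q x m * theta_sum r y) has_sum theta_sum q x * theta_sum r y) UNIV"
    using has_sum_cmult_left[OF has_sum_theta_term[OF q x]] by simp
  have "(\<lambda>p. norm (case p of (m, n) \<Rightarrow> theta_term q x m * theta_term r y n)) summable_on (UNIV \<times> UNIV)"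
  proof (rule Infinite_Sum.abs_summable_on_Sigma_iff[THEN iffD2], intro conjI ballI)
    show "(\<lambda>n. norm (case (m, n) of (m, n) \<Rightarrow> theta_term q x m * theta_term r y n)) summable_on UNIV" for m
      using abs_summable_theta_term[OF r y] by (auto simp: abs_mult intro!: summable_on_cmult_right)
    have "(\<lambda>m. norm (theta_term q x m) * (\<Sum>\<^sub>\<infinity>n. norm (theta_term r y n))) summable_on UNIV"
      using abs_summable_theta_term[OF q x] by (rule summable_on_cmult_left)
    moreover have "0 \<le> (\<Sum>\<^sub>\<infinity>n. \<bar>theta_term r y n\<bar>)"
      by (rule infsum_nonneg) simp
    ultimately show "(\<lambda>m. norm (\<Sum>\<^sub>\<infinity>n. norm (case (m, n) of (m, n) \<Rightarrow> theta_term q x m * theta_term r y n))) summable_on UNIV"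
      by (simp add: abs_mult infsum_cmult_right')
  qed
  then show "(\<lambda>(m, n). theta_term q x m * theta_term r y n) summable_on (UNIV \<times> UNIV)"
    by (rule abs_summable_summable)
qed

text \<open>
  The sum over \<open>(m, n)\<close> is split according to the parity of \<open>m + n\<close>; on each class
  \<open>((m + n) / 2, (m - n) / 2)\<close> separates the variables.
\<close>
lemma theta_sum_addition:
  assumes q: "0 < q" "q < 1" and x: "x \<noteq> 0" and y: "y \<noteq> 0"
  shows "theta_sum q (x * y) * theta_sum q (x / y) =
    theta_sum (q^2) (- (x^2)) * theta_sum (q^2) (- q * y^2) -
    x / y * theta_sum (q^2) (- q * x^2) * theta_sum (q^2) (- (y^2))"
proof -
  let ?f = "\<lambda>(m, n). theta_term q (x * y) m * theta_term q (x / y) n"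
  have q2: "0 < q^2" "q^2 < 1"
    using q by (auto simp: power_less_one_iff)
  have nz: "- (x^2) \<noteq> 0" "- q * x^2 \<noteq> 0" "- (y^2) \<noteq> 0" "- q * y^2 \<noteq> 0"
    using q x y by auto
  have powr2: "(q^2) powr a = q powr (2 * a)" for a
    using q by (simp add: powr_powr flip: powr_numeral)
  \<comment> \<open>At negated squares the terms carry no sign. The extra factor \<open>q\<close> in
    the second formula turns the exponent \<open>i * (i - 1)\<close> into
    \<open>i * i\<close>.\<close>
  have sq: "theta_term (q^2) (- (z^2)) i = z powi (2 * i) * q powr (i * (i - 1))" if "z \<noteq> 0" for z i
    using that by (simp add: theta_term_def powr2 power_int_mult)
  have sq': "theta_term (q^2) (- q * z^2) i = z powi (2 * i) * q powr (i * i)" if "z \<noteq> 0" for z i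
  proof -
    have "(q * z^2) powi i = q powr i * z powi (2 * i)"
      using q that by (simp add: power_int_mult_distrib power_int_mult powr_real_of_int')
    then show ?thesis
      by (simp add: theta_term_def powr2 diff_divide_distrib algebra_simps flip: powr_add)
  qed
  have expand: "?f (m, n) = (- 1) powi (m + n) * x powi (m + n) * y powi (m - n) *
      q powr ((m * (m - 1) + n * (n - 1)) / 2)" for m n
  proof -
    have "(- (x * y)) powi m * (- (x / y)) powi n = (- 1) powi (m + n) * x powi (m + n) * y powi (m - n)"
      using x y
      by (simp add: power_int_minus_left power_int_mult_distrib power_int_divide_distrib power_int_add power_int_diff)
    then show ?thesis
      by (simp add: theta_term_def add_divide_distrib powr_add mult_ac)
  qed
  have even: "(?f has_sum (theta_sum (q^2) (- (x^2)) * theta_sum (q^2) (- q * y^2))) {(m, n). even (m + n)}"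
  proof (rule iffD1[OF has_sum_reindex_bij_witness[where S = "UNIV \<times> UNIV"
      and i = "\<lambda>(m, n). ((m + n) div 2, (m - n) div 2)" and j = "\<lambda>(i, j). (i + j, i - j)", OF _ _ _ _ _ refl]])
    show "((\<lambda>(i, j). theta_term (q^2) (- (x^2)) i * theta_term (q^2) (- q * y^2) j) has_sum
        (theta_sum (q^2) (- (x^2)) * theta_sum (q^2) (- q * y^2))) (UNIV \<times> UNIV)"
      by (rule has_sum_theta_product[OF q2 q2 nz(1) nz(4)])
  next
    fix p :: "int \<times> int"
    obtain i j where p: "p = (i, j)" by fastforce
    show "(case (case p of (i, j) \<Rightarrow> (i + j, i - j)) of (m, n) \<Rightarrow> ((m + n) div 2, (m - n) div 2)) = p"
      by (simp add: p)
    show "(case p of (i, j) \<Rightarrow> (i + j, i - j)) \<in> {(m, n). even (m + n)}"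
      by (simp add: p)
    have "q powr (i * (i - 1)) * q powr (j * j) = q powr (((i + j) * ((i + j) - 1) + (i - j) * ((i - j) - 1)) / 2)"
      unfolding powr_add[symmetric] by (simp add: algebra_simps add_divide_distrib diff_divide_distrib)
    then show "?f (case p of (i, j) \<Rightarrow> (i + j, i - j)) =
        (case p of (i, j) \<Rightarrow> theta_term (q^2) (- (x^2)) i * theta_term (q^2) (- q * y^2) j)"
      unfolding p by (simp only: prod.case expand[unfolded prod.case] sq[OF x] sq'[OF y]) (simp add: mult_ac power_int_minus_left)
  next
    fix p :: "int \<times> int"
    assume "p \<in> {(m, n). even (m + n)}"
    then obtain m n where p: "p = (m, n)" "even (m + n)" by auto
    from p(2) obtain a where "m + n = 2 * a" by (rule evenE)
    then have "m + n = 2 * a" "m - n = 2 * (a - n)" "m = 2 * a - n" by simp_all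
    then show "(case (case p of (m, n) \<Rightarrow> ((m + n) div 2, (m - n) div 2)) of (i, j) \<Rightarrow> (i + j, i - j)) = p"
      unfolding p prod.case by (simp only: nonzero_mult_div_cancel_left) simp
  qed simp
  \<comment> \<open>On this class \<open>m + n = 2 * i + 1\<close> and
    \<open>m - n = 2 * j - 1\<close>. The odd powers of \<open>x\<close> and \<open>y\<close> leave
    the factor \<open>x / y\<close>, and \<open>(- 1) powi (m + n)\<close> gives the minus
    sign.\<close>
  have odd: "(?f has_sum (- (x / y * (theta_sum (q^2) (- q * x^2) * theta_sum (q^2) (- (y^2)))))) {(m, n). odd (m + n)}"
  proof (rule iffD1[OF has_sum_reindex_bij_witness[where S = "UNIV \<times> UNIV"
      and i = "\<lambda>(m, n). ((m + n - 1) div 2, (m - n + 1) div 2)" and j = "\<lambda>(i, j). (i + j, i - j + 1)", OF _ _ _ _ _ refl]])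
    show "((\<lambda>(i, j). - (x / y * (theta_term (q^2) (- q * x^2) i * theta_term (q^2) (- (y^2)) j))) has_sum
        (- (x / y * (theta_sum (q^2) (- q * x^2) * theta_sum (q^2) (- (y^2)))))) (UNIV \<times> UNIV)"
      using has_sum_uminusI[OF has_sum_cmult_right[OF has_sum_theta_product[OF q2 q2 nz(2) nz(3)], of "x / y"]]
      by (simp add: case_prod_unfold)
  next
    fix p :: "int \<times> int"
    obtain i j where p: "p = (i, j)" by fastforce
    show "(case (case p of (i, j) \<Rightarrow> (i + j, i - j + 1)) of (m, n) \<Rightarrow> ((m + n - 1) div 2, (m - n + 1) div 2)) = p"
      by (simp add: p)
    show "(case p of (i, j) \<Rightarrow> (i + j, i - j + 1)) \<in> {(m, n). odd (m + n)}"
      by (simp add: p)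
    have "q powr (i * i) * q powr (j * (j - 1)) = q powr (((i + j) * ((i + j) - 1) + (i - j + 1) * ((i - j + 1) - 1)) / 2)"
      unfolding powr_add[symmetric] by (simp add: algebra_simps add_divide_distrib diff_divide_distrib)
    moreover have "x powi (2 * i + 1) * y powi (2 * j - 1) = x / y * (x powi (2 * i) * y powi (2 * j))"
      using x y by (simp add: power_int_add power_int_diff)
    ultimately show "?f (case p of (i, j) \<Rightarrow> (i + j, i - j + 1)) =
        (case p of (i, j) \<Rightarrow> - (x / y * (theta_term (q^2) (- q * x^2) i * theta_term (q^2) (- (y^2)) j)))"
      unfolding p by (simp only: prod.case expand[unfolded prod.case] sq[OF y] sq'[OF x]) (simp add: mult_ac power_int_minus_left)
  next
    fix p :: "int \<times> int"
    assume "p \<in> {(m, n). odd (m + n)}"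
    then obtain m n where p: "p = (m, n)" "odd (m + n)" by auto
    from p(2) obtain a where "m + n = 2 * a + 1" by (rule oddE)
    then have "m + n - 1 = 2 * a" "m - n + 1 = 2 * (a + 1 - n)" "m = 2 * a + 1 - n" by simp_all
    then show "(case (case p of (m, n) \<Rightarrow> ((m + n - 1) div 2, (m - n + 1) div 2)) of (i, j) \<Rightarrow> (i + j, i - j + 1)) = p"
      unfolding p prod.case by (simp only: nonzero_mult_div_cancel_left) simp
  qed simp
  have "(?f has_sum (theta_sum (q^2) (- (x^2)) * theta_sum (q^2) (- q * y^2) +
      - (x / y * (theta_sum (q^2) (- q * x^2) * theta_sum (q^2) (- (y^2)))))) ({(m, n). even (m + n)} \<union> {(m, n). odd (m + n)})"
    by (rule has_sum_Un_disjoint[OF even odd]) auto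
  moreover have "{(m, n). even (m + n)} \<union> {(m, n). odd (m + n)} = (UNIV \<times> UNIV :: (int \<times> int) set)"
    by auto
  ultimately show ?thesis
    using has_sum_unique[OF has_sum_theta_product[OF q q, of "x * y" "x / y"]] x y by (simp add: mult_ac)
qed

theorem weierstrass_three_term:
  assumes q: "0 < q" "q < 1" and nz: "x \<noteq> 0" "y \<noteq> 0" "u \<noteq> 0" "v \<noteq> 0"
  defines "J \<equiv> theta_prod q"
  shows "J (x * y) * J (x / y) * (J (u * v) * J (u / v)) - J (x * v) * J (x / v) * (J (u * y) * J (u / y)) =
    u / y * (J (y * v) * J (y / v) * (J (x * u) * J (x / u)))"
proof -
  \<comment> \<open>Division by \<open>x\<close> makes the right-hand side of the addition formula
    \<open>a\<close> times the determinant of \<open>(P a, Q a)\<close> and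
    \<open>(P b, Q b)\<close>.\<close>
  define P where "P x = theta_sum (q^2) (- (x^2)) / x" for x
  define Q where "Q x = theta_sum (q^2) (- q * x^2)" for x
  define \<phi> where "\<phi> = qpoch_inf q"
  have \<phi>: "\<phi> \<noteq> 0"
    using qpoch_inf_pos[OF q] by (simp add: \<phi>_def)
  have D: "\<phi>^2 * (J (a * b) * J (a / b)) = a * (P a * Q b - P b * Q a)" if "a \<noteq> 0" "b \<noteq> 0" for a b
  proof -
    have "\<phi>^2 * (J (a * b) * J (a / b)) = theta_sum q (a * b) * theta_sum q (a / b)"
      by (simp add: theta_sum_def J_def \<phi>_def power2_eq_square)
    also have "\<dots> = a * (P a * Q b - P b * Q a)"
      using that by (simp add: theta_sum_addition[OF q] P_def Q_def field_simps)
    finally show ?thesis .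
  qed
  have DD: "\<phi>^4 * (J (a * b) * J (a / b) * (J (c * d) * J (c / d))) =
      a * c * ((P a * Q b - P b * Q a) * (P c * Q d - P d * Q c))"
    if "a \<noteq> 0" "b \<noteq> 0" "c \<noteq> 0" "d \<noteq> 0" for a b c d
  proof -
    have "\<phi>^4 * (J (a * b) * J (a / b) * (J (c * d) * J (c / d))) =
        (\<phi>^2 * (J (a * b) * J (a / b))) * (\<phi>^2 * (J (c * d) * J (c / d)))"
      by (simp add: power4_eq_xxxx power2_eq_square mult_ac)
    also have "\<dots> = a * (P a * Q b - P b * Q a) * (c * (P c * Q d - P d * Q c))"
      by (simp only: D[OF that(1,2)] D[OF that(3,4)])
    finally show ?thesis
      by (simp only: mult_ac)
  qed
  \<comment> \<open>All terms carry the prefactor \<open>x * u\<close>: on the right,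
    \<open>u / y\<close> converts \<open>y * x\<close> into it. What remains is the Pluecker
    relation between the 2 by 2 determinants of four vectors.\<close>
  have *: "\<phi>^4 * (J (x * y) * J (x / y) * (J (u * v) * J (u / v)) - J (x * v) * J (x / v) * (J (u * y) * J (u / y))) =
    u / y * (\<phi>^4 * (J (y * v) * J (y / v) * (J (x * u) * J (x / u))))"
    unfolding right_diff_distrib using nz
    by (simp only: DD[OF nz(1,2,3,4)] DD[OF nz(1,4,3,2)] DD[OF nz(2,4,1,3)]) (simp add: field_simps)
  have "\<phi>^4 \<noteq> 0"
    using \<phi> by simp
  from mult_left_cancel[OF this, THEN iffD1, OF trans[OF * mult.left_commute]]
  show ?thesis .
qed

subsection \<open>Normalised theta functions\<close>

lemma theta_prod_reflect: "q > 0 \<Longrightarrow> x \<noteq> 0 \<Longrightarrow> theta_prod q (q / x) = theta_prod q x"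
  unfolding theta_prod_def by (intro prodinf_cong) (simp add: field_simps)

text \<open>In the series, replacing \<open>x\<close> by \<open>q * x\<close> raises the summation
  index by one, up to the factor \<open>- (1 / x)\<close>.\<close>

lemma theta_prod_shift:
  assumes q: "0 < q" "q < 1" and x: "x \<noteq> 0"
  shows "theta_prod q (q * x) = - theta_prod q x / x"
proof -
  have eq: "theta_term q (q * x) n = - (1 / x) * theta_term q x (n + 1)" for n
  proof -
    have "(- (q * x)) powi n = q powr n * (- x) powi n"
      using q power_int_mult_distrib[of q "- x" n] by (simp add: powr_real_of_int')
    moreover have "q powr n * q powr (n * (n - 1) / 2) = q powr ((n + 1) * (n + 1 - 1) / 2)"
      unfolding powr_add[symmetric] by (rule arg_cong) (simp add: field_simps)
    ultimately show ?thesis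
      using x by (simp add: theta_term_def power_int_add mult_ac)
  qed
  have "((\<lambda>n. - (1 / x) * theta_term q x (n + 1)) has_sum (- (1 / x) * theta_sum q x)) UNIV"
  proof (rule has_sum_cmult_right)
    have "bij (\<lambda>n::int. n + 1)"
      by (rule bij_betw_byWitness[of _ "\<lambda>n. n - 1"]) auto
    then show "((\<lambda>n. theta_term q x (n + 1)) has_sum theta_sum q x) UNIV"
      using has_sum_reindex_bij_betw has_sum_theta_term[OF q x] by blast
  qed
  then have "(theta_term q (q * x) has_sum (- (1 / x) * theta_sum q x)) UNIV"
    unfolding eq[symmetric] .
  moreover have "(theta_term q (q * x) has_sum theta_sum q (q * x)) UNIV"
    using q x by (intro has_sum_theta_term) auto
  ultimately have "theta_sum q (q * x) = - (1 / x) * theta_sum q x"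
    by (rule has_sum_unique[symmetric])
  then have "qpoch_inf q * theta_prod q (q * x) = qpoch_inf q * (- theta_prod q x / x)"
    by (simp add: theta_sum_def)
  then show ?thesis
    using qpoch_inf_pos[OF q] by (simp only: mult_cancel_left) simp
qed

text \<open>Factor by factor, \<open>(1 - a) * (1 + a) = 1 - a^2\<close>.\<close>

lemma theta_prod_square:
  assumes q: "0 < q" "q < 1" and x: "x \<noteq> 0"
  shows "theta_prod q x * theta_prod q (- x) = theta_prod (q^2) (x^2)"
  unfolding theta_prod_def
  by (subst prodinf_mult[OF theta_prod_convergent[OF q] theta_prod_convergent[OF q]], rule prodinf_cong)
     (use x in \<open>simp add: field_simps power2_eq_square power_mult_distrib\<close>)

text \<open>The factors in base \<open>q\<close> split by the parity of the exponent of
  \<open>q\<close>: even exponents give the product at \<open>x\<close>, odd ones the product at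
  \<open>q * x\<close>. For partial products, \<open>N\<close> steps on the left match
  \<open>2 * N\<close> on the right.\<close>

lemma theta_prod_double:
  assumes q: "0 < q" "q < 1" and x: "x \<noteq> 0"
  shows "theta_prod (q^2) x * theta_prod (q^2) (q * x) = theta_prod q x"
proof -
  have q2: "0 < q^2" "q^2 < 1"
    using q by (auto simp: power_less_one_iff)
  let ?P = "\<lambda>q x N. \<Prod>k<N. (1 - x * q ^ k) * (1 - q ^ Suc k / x)"
  have "?P (q^2) x N * ?P (q^2) (q * x) N = ?P q x (2 * N)" for N
  proof (induction N)
    case (Suc N)
    have "(q^2) ^ N = q ^ (2 * N)" "(q^2) ^ Suc N = q ^ Suc (Suc (2 * N))"
      by (simp_all add: power_mult power2_eq_square)
    moreover have "q ^ Suc (Suc (2 * N)) / (q * x) = q ^ Suc (2 * N) / x"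
      using q by simp
    moreover have "q * x * q ^ (2 * N) = x * q ^ Suc (2 * N)"
      by simp
    ultimately show ?case
      using Suc.IH by (simp add: mult_ac del: power_Suc)
  qed simp
  moreover have "(\<lambda>N. ?P (q^2) x N * ?P (q^2) (q * x) N) \<longlonglongrightarrow>
      theta_prod (q^2) x * theta_prod (q^2) (q * x)"
    by (intro tendsto_mult theta_prod_tendsto q2)
  moreover have "(\<lambda>N. ?P q x (2 * N)) \<longlonglongrightarrow> theta_prod q x"
    by (rule filterlim_compose[OF theta_prod_tendsto[OF q]])
       (auto intro!: filterlim_subseq simp: strict_mono_def)
  ultimately show ?thesis
    by (simp add: LIMSEQ_unique)
qed

section \<open>Normalisation by a power of \<open>q\<close>\<close>

text \<open>This is \<open>M / 2\<close> times the second Bernoulli polynomial at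
  \<open>a / M\<close>. The non-constant terms absorb the factors in the reflection and shift
  formulas; the constant \<open>M / 12\<close> keeps the passage from \<open>M\<close> to
  \<open>2 * M\<close> free of powers of \<open>q\<close>.\<close>

definition theta_exp :: "real \<Rightarrow> real \<Rightarrow> real" where
  "theta_exp M a = a^2 / (2 * M) - a / 2 + M / 12"

definition theta_s :: "real \<Rightarrow> real \<Rightarrow> real \<Rightarrow> real" where
  "theta_s q M a = q powr theta_exp M a * theta_prod (q powr M) (q powr a)"

text \<open>The companion with negated argument: even and \<open>M\<close>-periodic in
  \<open>a\<close>, where \<open>theta_s\<close> is odd and changes sign under a shift by
  \<open>M\<close>.\<close>

definition theta_c :: "real \<Rightarrow> real \<Rightarrow> real \<Rightarrow> real" where
  "theta_c q M a = q powr theta_exp M a * theta_prod (q powr M) (- (q powr a))"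

lemma powr_base_pos: "0 < (q::real) \<Longrightarrow> 0 < q powr M"
  by simp

lemma powr_base_less_one: "0 < q \<Longrightarrow> q < (1::real) \<Longrightarrow> 0 < M \<Longrightarrow> q powr M < 1"
  by (simp add: powr01_less_one)

lemma powr_theta_exp_pair:
  assumes M: "M > 0"
  shows "q powr theta_exp M (x + y) * q powr theta_exp M (x - y) = q powr ((x^2 + y^2) / M + M / 6) * q powr (- x)"
  unfolding powr_add[symmetric] using M
  by (intro arg_cong[of _ _ "(powr) q"]) (simp add: theta_exp_def field_simps power2_eq_square)

text \<open>The first factor on the right is symmetric in all four variables, hence common to the
  terms of the three-term relation. The second factor absorbs the coefficient \<open>u / y\<close>
  there.\<close>

lemma powr_theta_exp_quadruple:
  assumes M: "M > 0"
  shows "q powr theta_exp M (x + y) * q powr theta_exp M (x - y) * (q powr theta_exp M (u + v) * q powr theta_exp M (u - v)) =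
    q powr ((x^2 + y^2 + u^2 + v^2) / M + M / 3) * q powr (- x - u)"
proof -
  have "q powr ((x^2 + y^2) / M + M / 6) * q powr (- x) * (q powr ((u^2 + v^2) / M + M / 6) * q powr (- u)) =
      q powr ((x^2 + y^2 + u^2 + v^2) / M + M / 3) * q powr (- x - u)"
    unfolding powr_add[symmetric] by (rule arg_cong[of _ _ "(powr) q"]) (simp add: add_divide_distrib)
  then show ?thesis
    unfolding powr_theta_exp_pair[OF M] .
qed

lemma theta_s_weierstrass:
  assumes q: "0 < q" "q < 1" and M: "M > 0"
  shows "theta_s q M (x + y) * theta_s q M (x - y) * (theta_s q M (u + v) * theta_s q M (u - v)) -
   theta_s q M (x + v) * theta_s q M (x - v) * (theta_s q M (u + y) * theta_s q M (u - y)) =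
   theta_s q M (y + v) * theta_s q M (y - v) * (theta_s q M (x + u) * theta_s q M (x - u))"
proof -
  define J where "J a = theta_prod (q powr M) (q powr a)" for a
  define K where "K = q powr ((x^2 + y^2 + u^2 + v^2) / M + M / 3)"
  have s4: "theta_s q M (a + b) * theta_s q M (a - b) * (theta_s q M (c + d) * theta_s q M (c - d)) =
      q powr ((a^2 + b^2 + c^2 + d^2) / M + M / 3) * q powr (- a - c) * (J (a + b) * J (a - b) * (J (c + d) * J (c - d)))"
    for a b c d
    unfolding powr_theta_exp_quadruple[OF M, symmetric] theta_s_def J_def by (simp only: mult_ac)
  have W: "J (x + y) * J (x - y) * (J (u + v) * J (u - v)) - J (x + v) * J (x - v) * (J (u + y) * J (u - y)) =
      q powr (u - y) * (J (y + v) * J (y - v) * (J (x + u) * J (x - u)))"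
    using weierstrass_three_term[OF powr_base_pos[OF q(1)] powr_base_less_one[OF q M], of "q powr x" "q powr y" "q powr u" "q powr v"] q
    by (simp add: J_def powr_add powr_diff)
  have "q powr (- x - u) * q powr (u - y) = q powr (- y - x)"
    unfolding powr_add[symmetric] by (rule arg_cong) simp
  then have "K * q powr (- x - u) * (J (x + y) * J (x - y) * (J (u + v) * J (u - v)) -
      J (x + v) * J (x - v) * (J (u + y) * J (u - y))) =
      K * q powr (- y - x) * (J (y + v) * J (y - v) * (J (x + u) * J (x - u)))"
    unfolding W by (simp add: mult_ac)
  then show ?thesis
    unfolding s4 K_def by (simp add: right_diff_distrib add_ac)
qed

text \<open>The three-term relation at \<open>- (q powr x)\<close> and \<open>- (q powr v)\<close>:
  a product or quotient involving exactly one of the two is negated and yields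
  \<open>theta_c\<close>, the others yield \<open>theta_s\<close>.\<close>

lemma theta_c_weierstrass:
  assumes q: "0 < q" "q < 1" and M: "M > 0"
  shows "theta_c q M (x + y) * theta_c q M (x - y) * (theta_c q M (u + v) * theta_c q M (u - v)) -
   theta_s q M (x + v) * theta_s q M (x - v) * (theta_s q M (u + y) * theta_s q M (u - y)) =
   theta_c q M (y + v) * theta_c q M (y - v) * (theta_c q M (x + u) * theta_c q M (x - u))"
proof -
  define J where "J a = theta_prod (q powr M) (q powr a)" for a
  define J' where "J' a = theta_prod (q powr M) (- (q powr a))" for a
  define K where "K = q powr ((x^2 + y^2 + u^2 + v^2) / M + M / 3)"
  have s4: "theta_s q M (a + b) * theta_s q M (a - b) * (theta_s q M (c + d) * theta_s q M (c - d)) =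
      q powr ((a^2 + b^2 + c^2 + d^2) / M + M / 3) * q powr (- a - c) * (J (a + b) * J (a - b) * (J (c + d) * J (c - d)))"
    for a b c d
    unfolding powr_theta_exp_quadruple[OF M, symmetric] theta_s_def J_def by (simp only: mult_ac)
  have c4: "theta_c q M (a + b) * theta_c q M (a - b) * (theta_c q M (c + d) * theta_c q M (c - d)) =
      q powr ((a^2 + b^2 + c^2 + d^2) / M + M / 3) * q powr (- a - c) * (J' (a + b) * J' (a - b) * (J' (c + d) * J' (c - d)))"
    for a b c d
    unfolding powr_theta_exp_quadruple[OF M, symmetric] theta_c_def J'_def by (simp only: mult_ac)
  have W: "J' (x + y) * J' (x - y) * (J' (u + v) * J' (u - v)) - J (x + v) * J (x - v) * (J (u + y) * J (u - y)) =
      q powr (u - y) * (J' (y + v) * J' (y - v) * (J' (x + u) * J' (x - u)))"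
    using weierstrass_three_term[OF powr_base_pos[OF q(1)] powr_base_less_one[OF q M], of "- (q powr x)" "q powr y" "q powr u" "- (q powr v)"] q
    by (simp add: J_def J'_def powr_add powr_diff)
  have "q powr (- x - u) * q powr (u - y) = q powr (- y - x)"
    unfolding powr_add[symmetric] by (rule arg_cong) simp
  then have "K * q powr (- x - u) * (J' (x + y) * J' (x - y) * (J' (u + v) * J' (u - v)) -
      J (x + v) * J (x - v) * (J (u + y) * J (u - y))) =
      K * q powr (- y - x) * (J' (y + v) * J' (y - v) * (J' (x + u) * J' (x - u)))"
    unfolding W by (simp add: mult_ac)
  then show ?thesis
    unfolding s4 c4 K_def by (simp add: right_diff_distrib add_ac)
qed

lemma theta_s_reflect:
  assumes q: "0 < q" "q < 1" and M: "M > 0"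
  shows "theta_s q M (M - a) = theta_s q M a"
proof -
  have "theta_exp M (M - a) = theta_exp M a"
    using M by (simp add: theta_exp_def field_simps power2_eq_square)
  then show ?thesis
    using theta_prod_reflect[of "q powr M" "q powr a"] q by (simp add: theta_s_def powr_diff)
qed

lemma theta_c_reflect:
  assumes q: "0 < q" "q < 1" and M: "M > 0"
  shows "theta_c q M (M - a) = theta_c q M a"
proof -
  have "theta_exp M (M - a) = theta_exp M a"
    using M by (simp add: theta_exp_def field_simps power2_eq_square)
  then show ?thesis
    using theta_prod_reflect[of "q powr M" "- (q powr a)"] q by (simp add: theta_c_def powr_diff)
qed

lemma powr_theta_exp_shift:
  assumes M: "M > 0"
  shows "q powr theta_exp M (a + M) = q powr theta_exp M a * q powr a"
  unfolding powr_add[symmetric] using M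
  by (intro arg_cong[of _ _ "(powr) q"]) (simp add: theta_exp_def field_simps power2_eq_square)

lemma theta_s_shift:
  assumes q: "0 < q" "q < 1" and M: "M > 0"
  shows "theta_s q M (a + M) = - theta_s q M a"
  using theta_prod_shift[OF powr_base_pos[OF q(1)] powr_base_less_one[OF q M], of "q powr a"] q
  by (simp add: theta_s_def powr_theta_exp_shift[OF M]) (simp add: powr_add mult.commute)

lemma theta_c_shift:
  assumes q: "0 < q" "q < 1" and M: "M > 0"
  shows "theta_c q M (a + M) = theta_c q M a"
  using theta_prod_shift[OF powr_base_pos[OF q(1)] powr_base_less_one[OF q M], of "- (q powr a)"] q
  by (simp add: theta_c_def powr_theta_exp_shift[OF M]) (simp add: powr_add mult.commute)

text \<open>Shift and reflection give two evaluations of \<open>theta_s q M (M - a)\<close>.\<close>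

lemma theta_s_minus:
  assumes q: "0 < q" "q < 1" and M: "M > 0"
  shows "theta_s q M (- a) = - theta_s q M a"
  using theta_s_shift[OF q M, of "- a"] theta_s_reflect[OF q M, of a] by simp

lemma theta_c_minus:
  assumes q: "0 < q" "q < 1" and M: "M > 0"
  shows "theta_c q M (- a) = theta_c q M a"
  using theta_c_shift[OF q M, of "- a"] theta_c_reflect[OF q M, of a] by simp

lemma theta_s_shift_of_nat:
  assumes q: "0 < q" "q < 1" and M: "M > 0"
  shows "theta_s q M (a + real n * M) = (- 1) ^ n * theta_s q M a"
proof (induction n)
  case (Suc n)
  then show ?case
    using theta_s_shift[OF q M, of "a + real n * M"] by (simp add: algebra_simps)
qed simp

lemma theta_s_shift_of_int:
  assumes q: "0 < q" "q < 1" and M: "M > 0"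
  shows "theta_s q M (a + of_int m * M) = (if even m then 1 else - 1) * theta_s q M a"
proof (cases m rule: int_cases2)
  case (nonneg n)
  then show ?thesis
    using theta_s_shift_of_nat[OF q M, of a n] by (simp add: minus_one_power_iff)
next
  case (nonpos n)
  then show ?thesis
    using theta_s_shift_of_nat[OF q M, of "a - real n * M" n] by (auto simp: minus_one_power_iff split: if_splits)
qed

lemma theta_c_shift_of_nat:
  assumes q: "0 < q" "q < 1" and M: "M > 0"
  shows "theta_c q M (a + real n * M) = theta_c q M a"
proof (induction n)
  case (Suc n)
  then show ?case
    using theta_c_shift[OF q M, of "a + real n * M"] by (simp add: algebra_simps)
qed simp

lemma theta_c_shift_of_int:
  assumes q: "0 < q" "q < 1" and M: "M > 0"
  shows "theta_c q M (a + of_int m * M) = theta_c q M a"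
proof (cases m rule: int_cases2)
  case (nonneg n)
  then show ?thesis
    using theta_c_shift_of_nat[OF q M, of a n] by simp
next
  case (nonpos n)
  then show ?thesis
    using theta_c_shift_of_nat[OF q M, of "a - real n * M" n] by simp
qed

section \<open>Passage between the moduli \<open>M\<close> and \<open>2 * M\<close>\<close>

lemma powr_double: "(q::real) powr (2 * M) = (q powr M)^2"
  by (simp add: power2_eq_square flip: powr_add)

lemma theta_s_double:
  assumes q: "0 < q" "q < 1" and M: "M > 0"
  shows "theta_s q (2 * M) a * theta_s q (2 * M) (a + M) = theta_s q M a"
proof -
  have "q powr theta_exp (2 * M) a * q powr theta_exp (2 * M) (a + M) = q powr theta_exp M a"
    unfolding powr_add[symmetric] using M
    by (intro arg_cong[of _ _ "(powr) q"]) (simp add: theta_exp_def field_simps power2_eq_square)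
  moreover have "q powr (a + M) = q powr M * q powr a"
    by (simp add: powr_add)
  ultimately show ?thesis
    using theta_prod_double[OF powr_base_pos[OF q(1)] powr_base_less_one[OF q M], of "q powr a"] q
    by (simp add: theta_s_def powr_double mult.assoc mult.left_commute[of "theta_prod _ _"])
qed

lemma theta_s_times_theta_c:
  assumes q: "0 < q" "q < 1" and M: "M > 0"
  shows "theta_s q M a * theta_c q M a = theta_s q (2 * M) (2 * a)"
proof -
  have "q powr theta_exp M a * q powr theta_exp M a = q powr theta_exp (2 * M) (2 * a)"
    unfolding powr_add[symmetric] using M
    by (intro arg_cong[of _ _ "(powr) q"]) (simp add: theta_exp_def field_simps power2_eq_square)
  moreover have "q powr (2 * a) = (q powr a)^2"
    by (simp add: power2_eq_square flip: powr_add)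
  ultimately show ?thesis
    using theta_prod_square[OF powr_base_pos[OF q(1)] powr_base_less_one[OF q M], of "q powr a"] q
    by (simp add: theta_s_def theta_c_def powr_double mult.assoc mult.left_commute[of "theta_prod _ _"])
qed

lemma theta_prod_pos:
  assumes q: "0 < q" "q < 1" and M: "M > 0" and "0 < a" "a < M"
  shows "theta_prod (q powr M) (q powr a) > 0"
  unfolding theta_prod_def
proof (rule less_0_prodinf[OF theta_prod_convergent[OF powr_base_pos[OF q(1)] powr_base_less_one[OF q M]]])
  fix n
  have small: "q powr b * (q powr M) ^ n < 1" if "b > 0" for b
  proof -
    have "q powr b * (q powr M) ^ n \<le> q powr b"
      using powr_base_pos[OF q(1)] powr_base_less_one[OF q M] by (intro mult_left_le) (auto simp: power_le_one)
    also have "\<dots> < 1"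
      using q that by (simp add: powr01_less_one)
    finally show ?thesis .
  qed
  have "(q powr M) ^ Suc n / q powr a = q powr (M - a) * (q powr M) ^ n"
    using q by (simp add: powr_diff)
  then show "0 < (1 - q powr a * (q powr M) ^ n) * (1 - (q powr M) ^ Suc n / q powr a)"
    using small[of a] small[of "M - a"] assms by (simp del: power_Suc)
qed

lemma theta_s_pos:
  assumes q: "0 < q" "q < 1" and M: "M > 0" and "0 < a" "a < M"
  shows "theta_s q M a > 0"
  using theta_prod_pos[OF assms] q by (simp add: theta_s_def)

lemma theta_c_pos:
  assumes q: "0 < q" "q < 1" and M: "M > 0"
  shows "theta_c q M a > 0"
proof -
  have "theta_prod (q powr M) (- (q powr a)) > 0"
    unfolding theta_prod_def using q
    by (intro less_0_prodinf[OF theta_prod_convergent[OF powr_base_pos[OF q(1)] powr_base_less_one[OF q M]]] mult_pos_pos)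
       (auto intro!: add_pos_nonneg simp del: power_Suc)
  then show ?thesis
    using q by (simp add: theta_c_def)
qed

subsection \<open>The theta function identity modulo 42\<close>

definition theta42 :: "real \<Rightarrow> int \<Rightarrow> real" where
  "theta42 q a = theta_s q 42 (of_int a)"

lemma theta42_minus:
  assumes q: "0 < q" "q < 1"
  shows "theta42 q (- a) = - theta42 q a"
  using theta_s_minus[OF q, of 42 "of_int a"] by (simp add: theta42_def)

lemma theta42_shift:
  assumes q: "0 < q" "q < 1"
  shows "theta42 q (a + 42 * m) = (if even m then 1 else - 1) * theta42 q a"
  using theta_s_shift_of_int[OF q, of 42 "of_int a" m] by (simp add: theta42_def mult.commute)

text \<open>Brings every index into the range from 0 to 21, so that numerical instances can be
  compared by rewriting.\<close>

lemma theta42_reduce: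
  assumes q: "0 < q" "q < 1"
  shows "theta42 q a = (if even (a div 42) then 1 else - 1) *
     theta42 q (if a mod 42 > 21 then 42 - a mod 42 else a mod 42)"
proof -
  have "theta42 q (42 - a mod 42) = theta42 q (a mod 42)"
    using theta42_shift[OF q, of "- (a mod 42)" 1] theta42_minus[OF q, of "a mod 42"] by simp
  moreover have "theta42 q a = (if even (a div 42) then 1 else - 1) * theta42 q (a mod 42)"
    using theta42_shift[OF q, of "a mod 42" "a div 42"] by simp
  ultimately show ?thesis
    by simp
qed

lemma theta42_nonzero:
  assumes q: "0 < q" "q < 1" and "\<not> 42 dvd a"
  shows "theta42 q a \<noteq> 0"
proof -
  have "0 < a mod 42" "a mod 42 < 42"
    using assms by (auto simp: order_less_le mod_eq_0_iff_dvd)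
  then have "theta42 q (a mod 42) > 0"
    using theta_s_pos[OF q, of 42 "of_int (a mod 42)"] by (simp add: theta42_def)
  then show ?thesis
    using theta42_shift[OF q, of "a mod 42" "a div 42"] by (auto split: if_splits)
qed

text \<open>After multiplication by \<open>G 12 * G 14\<close>, the relations \<open>W1\<close> and
  \<open>W2\<close> turn the left-hand side into a monomial times
  \<open>G 16 * G 1 * G 20 - G 2 * G 8 * G 13\<close>. This bracket is a multiple of
  \<open>C 8 - C 1\<close>, a difference of modulus-21 functions, which the relation
  \<open>W3\<close> evaluates as a product.\<close>

theorem theta42_identity:
  assumes q: "0 < q" "q < 1" and k: "coprime k 42"
  defines "G \<equiv> \<lambda>r. theta42 q (k * r)"
  shows "(\<Prod>r\<in>{2, 8, 13, 15}. G r) - (\<Prod>r\<in>{4, 5, 9, 16}. G r) =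
    (\<Prod>r\<in>{1, 2, 3, 4, 5, 7, 8, 9, 11, 13, 15, 16, 17, 18, 19, 20}. G r)"
proof -
  have "odd k"
    using k by (metis coprime_common_divisor dvd_triv_left even_numeral odd_one)
  then obtain m where m: "k = 2 * m + 1"
    by (rule oddE)
  \<comment> \<open>The sign comes from \<open>21 * k = 21 + 42 * m\<close>: it arises when a shift
    of the index by 21 is read as a shift of \<open>r\<close> by 21.\<close>
  define \<epsilon> :: real where "\<epsilon> = (if even m then 1 else - 1)"
  have \<epsilon>: "\<epsilon> * \<epsilon> = 1"
    by (simp add: \<epsilon>_def)
  define S where "S r = theta_s q 21 (of_int (k * r))" for r
  define C where "C r = theta_c q 21 (of_int (k * r))" for r
  have nz: "G r \<noteq> 0" if "0 < r" "r < 42" for r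
  proof -
    have "\<not> 42 dvd r"
      using that zdvd_not_zless by blast
    then have "\<not> 42 dvd k * r"
      using k by (simp add: coprime_commute coprime_dvd_mult_right_iff)
    then show ?thesis
      unfolding G_def by (rule theta42_nonzero[OF q])
  qed
  have G_minus: "G (- r) = - G r" for r
    using theta42_minus[OF q, of "k * r"] by (simp add: G_def)
  have G_reflect: "G (42 - r) = G r" for r
    using theta42_shift[OF q, of "- (k * r)" k] theta42_minus[OF q, of "k * r"] \<open>odd k\<close>
    by (simp add: G_def algebra_simps)
  \<comment> \<open>The functions \<open>S\<close> and \<open>C\<close> of modulus 21 are now
    expressed through \<open>G\<close>. The index \<open>21 - r\<close> is the reflection of
    \<open>r + 21\<close>.\<close>
  have S: "S r = \<epsilon> * (G r * G (21 - r))" for r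
  proof -
    have "k * r + 21 = k * (42 - (21 - r)) + 42 * (- m)"
      by (simp add: m algebra_simps)
    then have "theta42 q (k * r + 21) = theta42 q (k * (42 - (21 - r)) + 42 * (- m))"
      by (rule arg_cong)
    also have "\<dots> = \<epsilon> * G (21 - r)"
      unfolding theta42_shift[OF q] G_reflect[unfolded G_def] by (simp add: \<epsilon>_def G_def)
    finally show ?thesis
      using theta_s_double[OF q, of 21 "of_int (k * r)"]
      by (simp add: S_def G_def theta42_def mult_ac)
  qed
  have C: "C r * (G r * G (21 - r)) = \<epsilon> * G (2 * r)" for r
  proof -
    have "S r * C r = G (2 * r)"
      using theta_s_times_theta_c[OF q, of 21 "of_int (k * r)"]
      by (simp add: S_def C_def G_def theta42_def mult_ac)
    then have "(\<epsilon> * \<epsilon>) * (C r * (G r * G (21 - r))) = \<epsilon> * G (2 * r)"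
      by (simp add: S mult_ac)
    then show ?thesis
      by (simp only: \<epsilon> mult_1)
  qed
  have W: "G (x + y) * G (x - y) * (G (u + v) * G (u - v)) - G (x + v) * G (x - v) * (G (u + y) * G (u - y)) =
      G (y + v) * G (y - v) * (G (x + u) * G (x - u))" for x y u v
    using theta_s_weierstrass[OF q, of 42 "of_int (k * x)" "of_int (k * y)" "of_int (k * u)" "of_int (k * v)"]
    by (simp add: G_def theta42_def algebra_simps)
  \<comment> \<open>The arguments are chosen so that \<open>W1\<close> and \<open>W2\<close> rewrite
    the two products of the claim after multiplication by the same
    \<open>G 12 * G 14\<close>.\<close>
  have W1: "G 8 * G 2 * (G 14 * G 12) - G 6 * G 4 * (G 16 * G 10) = - (G 4 * G 2 * (G 18 * G 8))"
    using W[of 5 3 13 1] G_minus[of 8] by simp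
  have W2: "G 10 * G 6 * (G 15 * G 13) - G 20 * G 18 * (G 15 * G 1) = G 14 * G 12 * (G 9 * G 5)"
    using W[of 19 13 14 1] G_reflect[of 10] G_reflect[of 15] G_reflect[of 9] by simp
  have C9: "C 12 = C 9"
  proof -
    have "C 12 = theta_c q 21 (of_int (k * 9))"
      using theta_c_shift_of_int[OF q, of 21 "- of_int (k * 9)" k] theta_c_minus[OF q, of 21 "of_int (k * 9)"]
      by (simp add: C_def mult.commute)
    then show ?thesis
      by (simp add: C_def)
  qed
  have C5: "C (- 5) = C 5"
    using theta_c_minus[OF q, of 21 "of_int (k * 5)"] by (simp add: C_def)
  \<comment> \<open>Half-integral multiples of \<open>k\<close>, whose sums and differences are
    integral multiples. Since \<open>C 12 = C 9\<close> and \<open>C (- 5) = C 5\<close>, both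
    \<open>C\<close>-terms share the factor \<open>C 2 * C 5 * C 9\<close>.\<close>
  have "C 5 * C 2 * (C 9 * C 8) - S 4 * S 3 * (S 10 * S 7) = C 2 * C 1 * (C 12 * C (- 5))"
    using theta_c_weierstrass[OF q, of 21 "7 * of_int k / 2" "3 * of_int k / 2" "17 * of_int k / 2" "of_int k / 2"]
    by (simp add: C_def S_def field_simps)
  then have W3: "C 2 * C 5 * C 9 * (C 8 - C 1) = S 3 * S 4 * S 7 * S 10"
    unfolding C9 C5 by (simp add: algebra_simps)
  have \<epsilon>4: "\<epsilon> * \<epsilon> * \<epsilon> * \<epsilon> = 1"
    using \<epsilon> by simp
  define D where "D = \<epsilon> * (C 8 - C 1)"
  have D1: "D * (G 8 * G 13 * G 1 * G 20) = G 16 * G 1 * G 20 - G 2 * G 8 * G 13"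
  proof -
    have "D * (G 8 * G 13 * G 1 * G 20) =
        \<epsilon> * (C 8 * (G 8 * G 13)) * (G 1 * G 20) - \<epsilon> * (C 1 * (G 1 * G 20)) * (G 8 * G 13)"
      by (simp add: D_def algebra_simps)
    also have "C 8 * (G 8 * G 13) = \<epsilon> * G 16"
      using C[of 8] by simp
    also have "C 1 * (G 1 * G 20) = \<epsilon> * G 2"
      using C[of 1] by simp
    finally show ?thesis
      by (simp add: mult.assoc[symmetric] \<epsilon>)
  qed
  \<comment> \<open>Multiplication by \<open>G 4 * G 10 * G 18\<close> produces the factors
    \<open>C 2\<close>, \<open>C 5\<close>, \<open>C 9\<close> to which \<open>W3\<close> applies.
    The same three values reappear from \<open>S 4\<close>, \<open>S 10\<close>, \<open>S 3\<close>
    and cancel, being nonzero.\<close>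
  have D2: "D = G 3 * G 17 * G 11 * G 7 * G 14 * (G 2 * G 19 * G 5 * G 16 * G 9 * G 12)"
  proof -
    have C': "\<epsilon> * G 4 = C 2 * (G 2 * G 19)" "\<epsilon> * G 10 = C 5 * (G 5 * G 16)" "\<epsilon> * G 18 = C 9 * (G 9 * G 12)"
      using C[of 2] C[of 5] C[of 9] by simp_all
    have S': "S 3 = \<epsilon> * (G 3 * G 18)" "S 4 = \<epsilon> * (G 4 * G 17)" "S 7 = \<epsilon> * (G 7 * G 14)" "S 10 = \<epsilon> * (G 10 * G 11)"
      using S[of 3] S[of 4] S[of 7] S[of 10] by simp_all
    have "D * (G 4 * G 10 * G 18) = (\<epsilon> * \<epsilon>) * (D * (G 4 * G 10 * G 18))"
      by (simp only: \<epsilon> mult_1)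
    also have "\<dots> = (\<epsilon> * G 4) * (\<epsilon> * G 10) * (\<epsilon> * G 18) * (C 8 - C 1)"
      by (simp only: D_def mult_ac)
    also have "\<dots> = C 2 * C 5 * C 9 * (C 8 - C 1) * (G 2 * G 19 * G 5 * G 16 * G 9 * G 12)"
      unfolding C' by (simp only: mult_ac)
    also have "\<dots> = (\<epsilon> * \<epsilon> * \<epsilon> * \<epsilon>) * (G 3 * G 17 * G 11 * G 7 * G 14 *
        (G 2 * G 19 * G 5 * G 16 * G 9 * G 12)) * (G 4 * G 10 * G 18)"
      unfolding W3 S' by (simp only: mult_ac)
    finally show ?thesis
      using nz[of 4] nz[of 10] nz[of 18] unfolding \<epsilon>4 by simp
  qed
  \<comment> \<open>Once \<open>W1\<close> and \<open>W2\<close> are inserted, the two terms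
    containing \<open>G 6 * G 10\<close> cancel.\<close>
  have "(G 2 * G 8 * G 13 * G 15 - G 4 * G 5 * G 9 * G 16) * (G 12 * G 14) =
      G 4 * G 15 * G 18 * (G 16 * G 1 * G 20 - G 2 * G 8 * G 13)"
  proof -
    have "(G 2 * G 8 * G 13 * G 15 - G 4 * G 5 * G 9 * G 16) * (G 12 * G 14) =
        G 13 * G 15 * (G 8 * G 2 * (G 14 * G 12)) - G 4 * G 16 * (G 14 * G 12 * (G 9 * G 5))"
      by (simp add: algebra_simps)
    also have "G 8 * G 2 * (G 14 * G 12) = G 6 * G 4 * (G 16 * G 10) - G 4 * G 2 * (G 18 * G 8)"
      using W1 by simp
    also note W2[symmetric]
    finally show ?thesis
      by (simp add: algebra_simps)
  qed
  also have "\<dots> = G 4 * G 15 * G 18 * (G 8 * G 13 * G 1 * G 20) *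
      (G 3 * G 17 * G 11 * G 7 * (G 2 * G 19 * G 5 * G 16 * G 9)) * (G 12 * G 14)"
    unfolding D1[symmetric] D2 by (simp only: mult_ac)
  finally have eq: "G 2 * G 8 * G 13 * G 15 - G 4 * G 5 * G 9 * G 16 =
      G 4 * G 15 * G 18 * (G 8 * G 13 * G 1 * G 20) *
      (G 3 * G 17 * G 11 * G 7 * (G 2 * G 19 * G 5 * G 16 * G 9))"
    using nz[of 12] nz[of 14] by simp
  have "(\<Prod>r\<in>{2, 8, 13, 15}. G r) - (\<Prod>r\<in>{4, 5, 9, 16}. G r) =
      G 2 * G 8 * G 13 * G 15 - G 4 * G 5 * G 9 * G 16"
    by simp
  also note eq
  also have "G 4 * G 15 * G 18 * (G 8 * G 13 * G 1 * G 20) *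
      (G 3 * G 17 * G 11 * G 7 * (G 2 * G 19 * G 5 * G 16 * G 9)) =
      (\<Prod>r\<in>{1, 2, 3, 4, 5, 7, 8, 9, 11, 13, 15, 16, 17, 18, 19, 20}. G r)"
    by simp
  finally show ?thesis .
qed

subsection \<open>Generating functions of partitions\<close>

lemma partitions_into_empty: "partitions_into {} n = (if n = 0 then {{#}} else {})"
  by (auto simp: partitions_into_def)

text \<open>Either \<open>s\<close> does not occur, or one copy of it can be removed; the rest may
  contain \<open>s\<close> again.\<close>

lemma partitions_into_insert:
  assumes "s > 0"
  shows "partitions_into (insert s F) n =
    partitions_into F n \<union> (if s \<le> n then add_mset s ` partitions_into (insert s F) (n - s) else {})"
    (is "?L = ?R")
proof (intro equalityI subsetI)
  fix P assume P: "P \<in> ?L"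
  show "P \<in> ?R"
  proof (cases "s \<in># P")
    case True
    then obtain Q where Q: "P = add_mset s Q"
      by (meson mset_add)
    with P have "s \<le> n" "Q \<in> partitions_into (insert s F) (n - s)"
      by (auto simp: partitions_into_def)
    with Q show ?thesis
      by auto
  next
    case False
    with P show ?thesis
      by (auto simp: partitions_into_def)
  qed
qed (auto simp: partitions_into_def split: if_splits)

lemma finite_partitions_into_finite:
  assumes "finite F" "0 \<notin> F"
  shows "finite (partitions_into F n)"
  using assms
proof (induction F arbitrary: n rule: finite_induct)
  case empty
  then show ?case
    by (simp add: partitions_into_empty)
next
  case (insert s F)
  then have "s > 0" by simp
  show ?case
  proof (induction n rule: less_induct)
    case (less n)
    then show ?case
      using insert \<open>s > 0\<close> by (subst partitions_into_insert) auto
  qed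
qed

lemma partitions_into_inter_lessThan:
  assumes "n < N"
  shows "partitions_into (S \<inter> {..<N}) n = partitions_into S n"
proof -
  have "x < N" if "x \<in># P" "sum_mset P = n" for P x
    using that assms by (metis le_add1 le_less_trans mset_add sum_mset.add_mset)
  then show ?thesis
    by (auto simp: partitions_into_def)
qed

lemma finite_partitions_into:
  assumes "0 \<notin> S"
  shows "finite (partitions_into S n)"
  using finite_partitions_into_finite[of "S \<inter> {..<Suc n}" n] assms
  by (simp add: partitions_into_inter_lessThan)

lemma partition_count_insert:
  assumes "finite F" "0 \<notin> F" "s > 0" "s \<notin> F"
  shows "partition_count (insert s F) n =
    partition_count F n + (if s \<le> n then partition_count (insert s F) (n - s) else 0)"
proof -
  let ?A = "if s \<le> n then add_mset s ` partitions_into (insert s F) (n - s) else {}"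
  have "finite (partitions_into F n)" "finite ?A" "partitions_into F n \<inter> ?A = {}"
    using assms by (auto simp: finite_partitions_into) (auto simp: partitions_into_def)
  then have "partition_count (insert s F) n = card (partitions_into F n) + card ?A"
    unfolding partition_count_def partitions_into_insert[OF \<open>s > 0\<close>, of F n] by (rule card_Un_disjoint)
  also have "card ?A = (if s \<le> n then partition_count (insert s F) (n - s) else 0)"
    by (auto simp: partition_count_def intro!: card_image inj_onI)
  finally show ?thesis
    by (simp add: partition_count_def)
qed

section \<open>Generating functions as reciprocals of products\<close>

text \<open>The recurrence gives \<open>A = C + q ^ s * A\<close> for the sum \<open>A\<close> of
  the new series, hence the new factor. The corresponding inequality for partial sums bounds them by
  \<open>C / (1 - q ^ s)\<close> and so secures convergence first.\<close>

lemma partition_generating_function_finite: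
  fixes q :: real
  assumes q: "0 < q" "q < 1" and "finite F" "0 \<notin> F"
  shows "(\<lambda>n. partition_count F n * q ^ n) sums (1 / (\<Prod>s\<in>F. 1 - q ^ s))"
  using \<open>finite F\<close> \<open>0 \<notin> F\<close>
proof (induction F rule: finite_induct)
  case empty
  have "(\<lambda>n. partition_count {} n * q ^ n) sums (\<Sum>n\<in>{0}. partition_count {} n * q ^ n)"
    by (rule sums_finite) (auto simp: partition_count_def partitions_into_empty)
  then show ?case
    by (simp add: partition_count_def partitions_into_empty)
next
  case (insert s F)
  then have s: "s > 0" and F: "finite F" "0 \<notin> F" "s \<notin> F" by auto
  define a where "a n = partition_count (insert s F) n * q ^ n" for n
  define c where "c n = partition_count F n * q ^ n" for n
  define C where "C = 1 / (\<Prod>s\<in>F. 1 - q ^ s)"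
  have c: "c sums C"
    using insert unfolding c_def C_def by auto
  have qs: "0 < q ^ s" "q ^ s < 1"
    using q s by (auto simp: power_less_one_iff)
  have nonneg: "a n \<ge> 0" "c n \<ge> 0" for n
    using q by (auto simp: a_def c_def)
  have a: "a n = c n + (if s \<le> n then q ^ s * a (n - s) else 0)" for n
  proof -
    have "q ^ n = q ^ s * q ^ (n - s)" if "s \<le> n"
      using that by (simp flip: power_add)
    then show ?thesis
      using partition_count_insert[OF F(1,2) s F(3), of n] by (simp add: a_def c_def distrib_right)
  qed
  have "(\<Sum>n<m. a n) \<le> C / (1 - q ^ s)" for m
  proof -
    have "(\<Sum>n<m. if s \<le> n then q ^ s * a (n - s) else 0) = (\<Sum>n\<in>{n. n < m \<and> s \<le> n}. q ^ s * a (n - s))"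
      by (auto simp: sum.If_cases Int_def)
    also have "\<dots> = (\<Sum>n\<in>{n. n + s < m}. q ^ s * a n)"
      by (rule sum.reindex_bij_witness[of _ "\<lambda>n. n + s" "\<lambda>n. n - s"]) auto
    also have "\<dots> \<le> (\<Sum>n<m. q ^ s * a n)"
      using nonneg qs by (intro sum_mono2) auto
    finally have "(\<Sum>n<m. a n) \<le> (\<Sum>n<m. c n) + q ^ s * (\<Sum>n<m. a n)"
      by (subst a) (simp add: sum.distrib sum_distrib_left)
    moreover have "(\<Sum>n<m. c n) \<le> C"
      using c nonneg by (intro sum_le_suminf[of c "{..<m}", THEN order_trans]) (auto simp: sums_iff)
    ultimately show ?thesis
      using qs by (simp add: field_simps)
  qed
  then have "summable a"
    using nonneg by (intro summableI_nonneg_bounded) auto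
  then have A: "a sums suminf a"
    by (rule summable_sums)
  have "(\<lambda>n. if s \<le> n then q ^ s * a (n - s) else 0) sums (q ^ s * suminf a)"
    using sums_mult[OF A, of "q ^ s"]
      sums_zero_iff_shift[of s "\<lambda>n. if s \<le> n then q ^ s * a (n - s) else 0" "q ^ s * suminf a"] by simp
  from sums_add[OF c this] have "a sums (C + q ^ s * suminf a)"
    unfolding a[symmetric] .
  with A have "suminf a = C + q ^ s * suminf a"
    by (rule sums_unique2)
  then have "suminf a = C / (1 - q ^ s)"
    using qs by (simp add: field_simps)
  also have "\<dots> = 1 / (\<Prod>s\<in>insert s F. 1 - q ^ s)"
    using F by (simp add: C_def mult.commute)
  finally show ?case
    using A by (simp add: a_def[abs_def])
qed

text \<open>Truncating \<open>S\<close> leaves small coefficients unchanged and never increases any.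
  The first fact bounds the partial sums by \<open>1 / P N\<close> for large \<open>N\<close>, hence
  by \<open>1 / L\<close>; the second gives \<open>1 / P N \<le> suminf a\<close>.\<close>

lemma partition_generating_function:
  fixes q :: real
  assumes q: "0 < q" "q < 1" and S: "0 \<notin> S" and h: "filterlim h at_top sequentially"
    and lim: "(\<lambda>N. \<Prod>s\<in>S \<inter> {..<h N}. 1 - q ^ s) \<longlonglongrightarrow> L" and L: "L > 0"
  shows "(\<lambda>n. partition_count S n * q ^ n) sums (1 / L)"
proof -
  define a where "a n = partition_count S n * q ^ n" for n
  define b where "b N n = partition_count (S \<inter> {..<h N}) n * q ^ n" for N n
  define P where "P N = (\<Prod>s\<in>S \<inter> {..<h N}. 1 - q ^ s)" for N
  have b: "b N sums (1 / P N)" for N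
    unfolding b_def P_def using S by (intro partition_generating_function_finite q) auto
  have limP: "(\<lambda>N. 1 / P N) \<longlonglongrightarrow> 1 / L"
    using lim L unfolding P_def by (intro tendsto_intros) auto
  have b_nonneg: "b N n \<ge> 0" for N n
    using q by (simp add: b_def)
  have b_le: "b N n \<le> a n" for N n
  proof -
    have "partitions_into (S \<inter> {..<h N}) n \<subseteq> partitions_into S n"
      by (auto simp: partitions_into_def)
    then show ?thesis
      using q card_mono[OF finite_partitions_into[OF S]]
      by (auto simp: a_def b_def partition_count_def intro!: mult_right_mono)
  qed
  have bound: "(\<Sum>n<m. a n) \<le> 1 / L" for m
  proof (rule tendsto_lowerbound[OF limP])
    have "eventually (\<lambda>N. m \<le> h N) sequentially"
      using h by (simp add: filterlim_at_top)
    then show "eventually (\<lambda>N. (\<Sum>n<m. a n) \<le> 1 / P N) sequentially"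
    proof eventually_elim
      case (elim N)
      have "(\<Sum>n<m. a n) = (\<Sum>n<m. b N n)"
        using elim by (intro sum.cong) (auto simp: a_def b_def partition_count_def partitions_into_inter_lessThan)
      also have "\<dots> \<le> suminf (b N)"
        using b[of N] b_nonneg by (intro sum_le_suminf) (auto simp: sums_iff)
      finally show ?case
        using b[of N] by (simp add: sums_iff)
    qed
  qed simp
  have a_nonneg: "a n \<ge> 0" for n
    using q by (simp add: a_def)
  then have "summable a"
    using bound by (intro summableI_nonneg_bounded)
  then have "suminf a \<le> 1 / L"
    using bound by (intro suminf_le_const)
  moreover have "1 / L \<le> suminf a"
  proof (rule tendsto_upperbound[OF limP])
    have "1 / P N \<le> suminf a" for N
      using suminf_le[of "b N" a] b[of N] b_le \<open>summable a\<close> by (auto simp: sums_iff)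
    then show "eventually (\<lambda>N. 1 / P N \<le> suminf a) sequentially"
      by simp
  qed simp
  ultimately show ?thesis
    using summable_sums[OF \<open>summable a\<close>] by (simp add: a_def[abs_def])
qed

section \<open>Comparison of coefficients\<close>

text \<open>If all coefficients before \<open>m\<close> vanish, division by \<open>q ^ m\<close> and
  the limit \<open>q \<rightarrow> 0\<close> from the right isolate \<open>d m\<close>.\<close>

lemma powser_eq_0_coeffs:
  fixes d :: "nat \<Rightarrow> real"
  assumes "\<And>q. 0 < q \<Longrightarrow> q < 1 \<Longrightarrow> (\<lambda>n. d n * q ^ n) sums 0"
  shows "d n = 0"
proof (induction n rule: less_induct)
  case (less m)
  define e where "e n = d (n + m)" for n
  have e: "(\<lambda>n. e n * q ^ n) sums 0" if q: "0 < q" "q < 1" for q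
  proof -
    have "(\<lambda>n. d (n + m) * q ^ (n + m)) sums 0"
      using less by (subst sums_zero_iff_shift) (auto intro!: assms q)
    from sums_mult[OF this, of "1 / q ^ m"] show ?thesis
      using q by (simp add: e_def power_add)
  qed
  \<comment> \<open>The limit at 0 is taken on both sides, whereas convergence is given for positive
    arguments only; it carries over to all smaller absolute values.\<close>
  have "summable (\<lambda>n. e n * x ^ n)" if "norm x < 1" for x
  proof -
    obtain y where y: "norm x < y" "y < 1"
      using \<open>norm x < 1\<close> dense by blast
    then have "0 < y"
      using norm_ge_zero[of x] by linarith
    from sums_summable[OF e[OF this y(2)]] show ?thesis
      by (rule powser_inside) (use y \<open>0 < y\<close> in simp)
  qed
  then have "((\<lambda>x. \<Sum>n. e n * x ^ n) \<longlongrightarrow> e 0) (at 0)"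
    by (intro powser_limit_0[of 1]) auto
  then have "((\<lambda>x. \<Sum>n. e n * x ^ n) \<longlongrightarrow> e 0) (at_right 0)"
    by (rule tendsto_mono[OF at_le, rotated]) simp
  moreover have "((\<lambda>x. \<Sum>n. e n * x ^ n) \<longlongrightarrow> 0) (at_right 0)"
  proof (rule tendsto_eventually)
    have "eventually (\<lambda>x. x \<in> {0<..<1::real}) (at_right 0)"
      by (rule eventually_at_right_real) simp
    then show "eventually (\<lambda>x. (\<Sum>n. e n * x ^ n) = 0) (at_right 0)"
      by eventually_elim (use e in \<open>auto simp: sums_iff\<close>)
  qed
  ultimately have "e 0 = 0"
    by (intro tendsto_unique[OF trivial_limit_at_right_real])
  then show ?case
    by (simp add: e_def)
qed

lemma coeffs_of_shifted_identity:
  fixes a b :: "nat \<Rightarrow> nat" and A B :: "real \<Rightarrow> real"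
  assumes "\<And>q. 0 < q \<Longrightarrow> q < 1 \<Longrightarrow> (\<lambda>n. real (a n) * q ^ n) sums A q"
    and "\<And>q. 0 < q \<Longrightarrow> q < 1 \<Longrightarrow> (\<lambda>n. real (b n) * q ^ n) sums B q"
    and "\<And>q. 0 < q \<Longrightarrow> q < 1 \<Longrightarrow> A q - q ^ k * B q = q ^ l"
  shows "a n = (if k \<le> n then b (n - k) else 0) + (if n = l then 1 else 0)"
proof -
  define d where "d n = real (a n) - (if k \<le> n then real (b (n - k)) else 0) - (if n = l then 1 else 0)" for n
  have "d n = 0"
  proof (rule powser_eq_0_coeffs)
    fix q :: real assume q: "0 < q" "q < 1"
    have "(\<lambda>n. (if k \<le> n then real (b (n - k)) else 0) * q ^ n) sums (q ^ k * B q)"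
      using sums_mult[OF assms(2)[OF q], of "q ^ k"]
        sums_zero_iff_shift[of k "\<lambda>n. (if k \<le> n then real (b (n - k)) else 0) * q ^ n" "q ^ k * B q"]
      by (simp add: power_add mult_ac)
    moreover have "(\<lambda>n. (if n = l then 1 else 0) * q ^ n) sums q ^ l"
      using sums_single[of l "\<lambda>n. q ^ n"] by (simp add: if_distrib[of "\<lambda>x. x * _"] cong: if_cong)
    ultimately have "(\<lambda>n. d n * q ^ n) sums (A q - q ^ k * B q - q ^ l)"
      unfolding d_def left_diff_distrib by (intro sums_diff assms(1)[OF q])
    then show "(\<lambda>n. d n * q ^ n) sums 0"
      using assms(3)[OF q] by simp
  qed
  then show ?thesis
    by (auto simp: d_def split: if_splits)
qed

subsection \<open>The partition identities\<close>

text \<open>For \<open>r\<close> from 1 to 20 the remainders of \<open>r\<close> and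
  \<open>- r\<close> are \<open>r\<close> and \<open>42 - r\<close>. Neither is 0, so positivity of
  \<open>n\<close> is automatic.\<close>

lemma pm_residues_iff:
  assumes "R \<subseteq> {1..20}"
  shows "n \<in> pm_residues R 42 \<longleftrightarrow> int n mod 42 \<in> R \<or> 42 - int n mod 42 \<in> R"
proof -
  have "[int n = r] (mod 42) \<longleftrightarrow> int n mod 42 = r" "[int n = - r] (mod 42) \<longleftrightarrow> 42 - int n mod 42 = r"
    if "r \<in> R" for r
  proof -
    have "1 \<le> r" "r \<le> 20"
      using that assms by auto
    then have "r mod 42 = r" "- r mod 42 = 42 - r"
      by (simp_all add: zmod_zminus1_eq_if)
    then show "[int n = r] (mod 42) \<longleftrightarrow> int n mod 42 = r" "[int n = - r] (mod 42) \<longleftrightarrow> 42 - int n mod 42 = r"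
      by (auto simp: Cong.cong_def)
  qed
  moreover have "n > 0" if "int n mod 42 \<in> R \<or> 42 - int n mod 42 \<in> R"
    using that assms by (cases n) auto
  ultimately show ?thesis
    unfolding pm_residues_def by blast
qed

text \<open>Since \<open>r < 21\<close>, the progressions \<open>42 * k + r\<close> and
  \<open>42 * k + (42 - r)\<close> are disjoint, and exactly \<open>N\<close> terms of each lie
  below \<open>42 * N\<close>. Quotient and remainder invert \<open>lo\<close> and
  \<open>hi\<close>.\<close>

lemma prod_pm_residues:
  fixes f :: "nat \<Rightarrow> real"
  assumes R: "R \<subseteq> {1..20}"
  shows "(\<Prod>s\<in>pm_residues R 42 \<inter> {..<42 * N}. f s) =
    (\<Prod>r\<in>R. \<Prod>k<N. f (42 * k + nat r) * f (42 * k + (42 - nat r)))"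
proof -
  define lo hi :: "int \<times> nat \<Rightarrow> nat"
    where "lo p = 42 * snd p + nat (fst p)" and "hi p = 42 * snd p + (42 - nat (fst p))" for p
  let ?I = "R \<times> {..<N}"
  have fin: "finite R"
    using R finite_subset by blast
  have r: "0 < fst p" "fst p < 21" if "p \<in> ?I" for p
    using R that by auto
  have lo: "lo p div 42 = snd p" "int (lo p) mod 42 = fst p" if "p \<in> ?I" for p
    using r[OF that] by (simp_all add: lo_def)
  have hi: "hi p div 42 = snd p" "int (hi p) mod 42 = 42 - fst p" if "p \<in> ?I" for p
  proof -
    have "int (hi p) = (42 - fst p) + 42 * int (snd p)"
      using r[OF that] by (simp add: hi_def)
    then show "int (hi p) mod 42 = 42 - fst p"
      using r[OF that] by (simp only: mod_mult_self2) (rule mod_pos_pos_trivial, simp_all)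
    show "hi p div 42 = snd p"
      using r[OF that] by (simp add: hi_def)
  qed
  have "pm_residues R 42 \<inter> {..<42 * N} = lo ` ?I \<union> hi ` ?I"
  proof (intro equalityI subsetI)
    fix n assume n: "n \<in> pm_residues R 42 \<inter> {..<42 * N}"
    then have k: "n div 42 < N"
      by (simp add: less_mult_imp_div_less mult.commute)
    from n consider "int n mod 42 \<in> R" | "42 - int n mod 42 \<in> R"
      using pm_residues_iff[OF R] by blast
    then show "n \<in> lo ` ?I \<union> hi ` ?I"
    proof cases
      case 1
      have "n = lo (int n mod 42, n div 42)"
        by (simp add: lo_def nat_mod_distrib)
      then show ?thesis
        using 1 k by blast
    next
      case 2
      have "n mod 42 < 42" by simp
      then have "n = hi (42 - int n mod 42, n div 42)"
        by (simp add: hi_def nat_diff_distrib' nat_mod_distrib)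
      then show ?thesis
        using 2 k by blast
    qed
  next
    fix n assume "n \<in> lo ` ?I \<union> hi ` ?I"
    then consider p where "p \<in> ?I" "n = lo p" | p where "p \<in> ?I" "n = hi p"
      by blast
    then have "int n mod 42 \<in> R \<or> 42 - int n mod 42 \<in> R" "n div 42 < N"
      by (cases; simp add: lo hi mem_Times_iff)+
    then show "n \<in> pm_residues R 42 \<inter> {..<42 * N}"
      unfolding pm_residues_iff[OF R, symmetric] by (simp only: div_less_iff_less_mult mult.commute) simp
  qed
  moreover have "lo ` ?I \<inter> hi ` ?I = {}"
  proof -
    have "lo p \<noteq> hi p'" if "p \<in> ?I" "p' \<in> ?I" for p p'
    proof
      assume "lo p = hi p'"
      then have "fst p = 42 - fst p'"
        using lo(2)[OF that(1)] hi(2)[OF that(2)] by (simp only:)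
      then show False
        using r[OF that(1)] r[OF that(2)] by simp
    qed
    then show ?thesis
      by blast
  qed
  ultimately have "(\<Prod>s\<in>pm_residues R 42 \<inter> {..<42 * N}. f s) = (\<Prod>s\<in>lo ` ?I. f s) * (\<Prod>s\<in>hi ` ?I. f s)"
    using fin by (simp add: prod.union_disjoint)
  also have "(\<Prod>s\<in>lo ` ?I. f s) = (\<Prod>p\<in>?I. f (lo p))"
    by (rule prod.reindex[unfolded o_def], rule inj_on_inverseI[where g = "\<lambda>n. (int n mod 42, n div 42)"])
       (simp only: lo prod.collapse)
  also have "(\<Prod>s\<in>hi ` ?I. f s) = (\<Prod>p\<in>?I. f (hi p))"
    by (rule prod.reindex[unfolded o_def], rule inj_on_inverseI[where g = "\<lambda>n. (42 - int n mod 42, n div 42)"])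
       (simp only: hi diff_diff_eq2 add_diff_cancel_left' prod.collapse)
  finally show ?thesis
    by (simp add: lo_def hi_def prod.cartesian_product prod.distrib[symmetric] case_prod_unfold)
qed

text \<open>The product \<open>T\<^sub>r\<close> without its normalising power of
  \<open>q\<close>.\<close>

definition theta_factor :: "real \<Rightarrow> int \<Rightarrow> real" where
  "theta_factor q r = theta_prod (q powr 42) (q powr of_int r)"

lemma theta_factor_pos: "0 < q \<Longrightarrow> q < 1 \<Longrightarrow> 0 < r \<Longrightarrow> r < 42 \<Longrightarrow> theta_factor q r > 0"
  unfolding theta_factor_def by (rule theta_prod_pos) auto

text \<open>With the cutoff \<open>42 * N\<close>, the product over the parts consists of the first
  \<open>N\<close> steps of each theta product, so its limit is known.\<close>

lemma partition_generating_function_pm_residues: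
  assumes q: "0 < q" "q < 1" and R: "R \<subseteq> {1..20}"
  shows "(\<lambda>n. real (partition_count (pm_residues R 42) n) * q ^ n) sums (1 / (\<Prod>r\<in>R. theta_factor q r))"
proof (rule partition_generating_function[OF q])
  show "0 \<notin> pm_residues R 42"
    by (simp add: pm_residues_def)
  show "filterlim (\<lambda>N::nat. 42 * N) at_top sequentially"
    by (rule filterlim_subseq) (simp add: strict_mono_def)
  have pow: "q powr 42 = q ^ 42"
    using q by (simp add: powr_numeral)
  have q42: "0 < q ^ 42" "q ^ 42 < 1"
    using q by (auto simp: power_less_one_iff)
  have "(\<Prod>s\<in>pm_residues R 42 \<inter> {..<42 * N}. 1 - q ^ s) =
      (\<Prod>r\<in>R. \<Prod>k<N. (1 - q powr r * (q ^ 42) ^ k) * (1 - (q ^ 42) ^ Suc k / q powr r))" for N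
    unfolding prod_pm_residues[OF R]
  proof (intro prod.cong refl)
    fix r k assume "r \<in> R"
    with R have "1 \<le> r" "r \<le> 20"
      by auto
    then have r: "q powr r = q ^ nat r" "nat r < 42"
      using q by (auto simp: powr_real_of_int)
    have pow_Suc: "q ^ (42 * Suc k) = q ^ (42 * k + (42 - nat r)) * q ^ nat r"
      using r(2) by (simp add: add.commute flip: power_add)
    have "q ^ (42 * k + (42 - nat r)) = (q ^ 42) ^ Suc k / q powr r"
      unfolding r(1) power_mult[symmetric] pow_Suc using q by simp
    moreover have "q ^ (42 * k + nat r) = q powr r * (q ^ 42) ^ k"
      by (simp add: r(1) power_add power_mult)
    ultimately show "(1 - q ^ (42 * k + nat r)) * (1 - q ^ (42 * k + (42 - nat r))) =
        (1 - q powr r * (q ^ 42) ^ k) * (1 - (q ^ 42) ^ Suc k / q powr r)"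
      by (simp only:)
  qed
  then show "(\<lambda>N. \<Prod>s\<in>pm_residues R 42 \<inter> {..<42 * N}. 1 - q ^ s) \<longlonglongrightarrow> (\<Prod>r\<in>R. theta_factor q r)"
    unfolding theta_factor_def pow by (simp only:) (intro tendsto_prod theta_prod_tendsto q42)
  show "0 < (\<Prod>r\<in>R. theta_factor q r)"
    using R by (intro prod_pos theta_factor_pos q) auto
qed

section \<open>Deduction from the theta function identity\<close>

text \<open>The guard \<open>21 < a\<close> prevents looping, as the index on the right is at most
  21.\<close>

lemma theta42_reduce_large [simp]:
  "0 < q \<Longrightarrow> q < 1 \<Longrightarrow> 21 < a \<Longrightarrow> theta42 q a = (if even (a div 42) then 1 else - 1) *
     theta42 q (if a mod 42 > 21 then 42 - a mod 42 else a mod 42)"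
  by (rule theta42_reduce)

text \<open>Up to the sign \<open>\<sigma>\<close>, the theta identity at multiples of
  \<open>m\<close> involves only the residues on which \<open>R\<close> and \<open>R'\<close> differ
  and their union. Division by the product over the union gives
  \<open>1 / ?P R - q ^ k * (1 / ?P R') = q ^ l\<close>. The exponents \<open>k\<close> and
  \<open>l\<close> are what remains of the normalisation, and \<open>q ^ l\<close> is the
  exceptional coefficient.\<close>

lemma partition_count_shifted:
  fixes R R' :: "int set" and k l n :: nat and \<sigma> :: real
  assumes sub: "R \<union> R' \<subseteq> {1..20}" and m: "m \<in> {1, 5, 11, 13, 17, 19}"
    and diff: "\<And>q. 0 < q \<Longrightarrow> q < 1 \<Longrightarrow> prod (theta42 q) (R' - R) - prod (theta42 q) (R - R') =
      \<sigma> * ((\<Prod>r\<in>{2, 8, 13, 15}. theta42 q (m * r)) - (\<Prod>r\<in>{4, 5, 9, 16}. theta42 q (m * r)))"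
    and prod: "\<And>q. 0 < q \<Longrightarrow> q < 1 \<Longrightarrow> prod (theta42 q) (R \<union> R') =
      \<sigma> * (\<Prod>r\<in>{1, 2, 3, 4, 5, 7, 8, 9, 11, 13, 15, 16, 17, 18, 19, 20}. theta42 q (m * r))"
    and k: "(\<Sum>r\<in>R - R'. theta_exp 42 (of_int r)) - (\<Sum>r\<in>R' - R. theta_exp 42 (of_int r)) = real k"
    and l: "(\<Sum>r\<in>R. theta_exp 42 (of_int r)) = real l"
  shows "partition_count (pm_residues R 42) n =
    (if k \<le> n then partition_count (pm_residues R' 42) (n - k) else 0) + (if n = l then 1 else 0)"
proof (rule coeffs_of_shifted_identity)
  fix q :: real assume q: "0 < q" "q < 1"
  let ?P = "\<lambda>R. \<Prod>r\<in>R. theta_factor q r"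
  let ?e = "\<lambda>R. \<Sum>r\<in>R. theta_exp 42 (of_int r)"
  define A B where "A = R - R'" and "B = R' - R"
  have fin: "finite R" "finite R'" "finite A" "finite B"
    using sub by (auto simp: A_def B_def intro: finite_subset)
  show "(\<lambda>n. real (partition_count (pm_residues R 42) n) * q ^ n) sums (1 / ?P R)"
    "(\<lambda>n. real (partition_count (pm_residues R' 42) n) * q ^ n) sums (1 / ?P R')"
    using sub by (intro partition_generating_function_pm_residues q; blast)+
  have theta: "prod (theta42 q) S = q powr ?e S * ?P S" if "finite S" for S
    using that q
    by (simp add: theta42_def[abs_def] theta_s_def theta_factor_def prod.distrib powr_sum)
  have pos: "?P A > 0" "?P B > 0" "?P R > 0" "?P R' > 0"
    using sub by (intro prod_pos theta_factor_pos q; auto simp: A_def B_def)+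
  have union: "prod f (R \<union> R') = prod f R * prod f B" "prod f R * prod f B = prod f R' * prod f A"
    for f :: "int \<Rightarrow> real"
  proof -
    show "prod f (R \<union> R') = prod f R * prod f B"
      using fin by (subst prod.union_disjoint[symmetric]) (auto simp: B_def intro!: prod.cong)
    also have "R \<union> R' = R' \<union> A"
      by (auto simp: A_def)
    finally show "prod f R * prod f B = prod f R' * prod f A"
      using fin by (subst (asm) prod.union_disjoint) (auto simp: A_def)
  qed
  have "coprime m 42"
    using m by (auto intro: prime_imp_coprime)
  from theta42_identity[OF q this]
  have "prod (theta42 q) B - prod (theta42 q) A = prod (theta42 q) R * prod (theta42 q) B"
    unfolding A_def B_def diff[OF q] union(1)[symmetric, unfolded B_def] prod[OF q] by simp
  moreover have "q powr ?e A = q powr ?e B * q ^ k"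
  proof -
    have "?e A = ?e B + real k"
      using k by (simp add: A_def B_def)
    then show ?thesis
      using q by (simp add: powr_add powr_realpow)
  qed
  moreover have "q powr ?e R = q ^ l"
    using l q by (simp add: powr_realpow)
  ultimately have "q powr ?e B * (?P B - q ^ k * ?P A) = q powr ?e B * (q ^ l * (?P R * ?P B))"
    unfolding theta[OF fin(1)] theta[OF fin(3)] theta[OF fin(4)] by (simp add: algebra_simps)
  then have eq: "?P B - q ^ k * ?P A = q ^ l * (?P R * ?P B)"
    using q by simp
  have nz: "?P A \<noteq> 0" "?P B \<noteq> 0" "?P R \<noteq> 0"
    using pos by linarith+
  \<comment> \<open>The common denominator \<open>?P R * ?P B\<close> equals
    \<open>?P R' * ?P A\<close>, both being the product over \<open>R \<union> R'\<close>.\<close>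
  have "1 / ?P R = 1 * ?P B / (?P R * ?P B)"
    by (rule nonzero_mult_divide_mult_cancel_right[OF nz(2), symmetric])
  moreover have "q ^ k * (1 / ?P R') = q ^ k * ?P A / (?P R * ?P B)"
    unfolding union(2) nonzero_mult_divide_mult_cancel_right[OF nz(1)] by (simp only: times_divide_eq_right mult_1_right)
  ultimately have "1 / ?P R - q ^ k * (1 / ?P R') = (?P B - q ^ k * ?P A) / (?P R * ?P B)"
    by (simp only: diff_divide_distrib mult_1_left)
  also have "\<dots> = q ^ l"
    unfolding eq by (rule nonzero_mult_div_cancel_right) (simp only: mult_eq_0_iff nz simp_thms)
  finally show "1 / ?P R - q ^ k * (1 / ?P R') = q ^ l" .
qed

text \<open>
  The hypotheses of the preceding lemma are numerical, so \<open>simplified\<close> discharges them. The unit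
  \<open>m\<close> carries part (i) to the part in question, and \<open>\<sigma>\<close> is the sign produced by reducing the indices.
  In parts (iii) and (vi), where \<open>m\<close> is 11 and 19, the sets \<open>S\<close> and \<open>T\<close> are exchanged.
\<close>

declare theta_exp_def [simp] insert_Diff_if [simp] prod.insert_if [simp]

lemmas partition_identity_1 = partition_count_shifted
  [where R = "{1, 3, 4, 5, 7, 9, 11, 16, 17, 18, 19, 20}"
    and R' = "{1, 2, 3, 7, 8, 11, 13, 15, 17, 18, 19, 20}"
    and m = 1 and \<sigma> = 1 and k = 1 and l = 0, simplified]

lemmas partition_identity_5 = partition_count_shifted
  [where R = "{1, 2, 5, 6, 7, 9, 10, 11, 13, 15, 16, 19}"
    and R' = "{1, 3, 4, 5, 6, 7, 11, 13, 15, 16, 17, 20}"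
    and m = 5 and \<sigma> = "- 1" and k = 0 and l = 2, simplified]

lemmas partition_identity_11 = partition_count_shifted
  [where R = "{1, 2, 5, 7, 8, 9, 10, 11, 12, 13, 15, 19}"
    and R' = "{1, 3, 4, 5, 7, 9, 10, 11, 12, 17, 19, 20}"
    and m = 11 and \<sigma> = 1 and k = 0 and l = 2, simplified]

lemmas partition_identity_13 = partition_count_shifted
  [where R = "{2, 3, 5, 7, 8, 9, 10, 11, 13, 17, 18, 19}"
    and R' = "{1, 3, 5, 7, 8, 11, 13, 15, 16, 17, 18, 20}"
    and m = 13 and \<sigma> = 1 and k = 2 and l = 0, simplified]

lemmas partition_identity_17 = partition_count_shifted
  [where R = "{3, 4, 5, 7, 8, 9, 10, 11, 12, 13, 17, 19}"
    and R' = "{1, 4, 5, 7, 9, 12, 13, 15, 16, 17, 19, 20}"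
    and m = 17 and \<sigma> = "- 1" and k = 3 and l = 0, simplified]

lemmas partition_identity_19 = partition_count_shifted
  [where R = "{1, 2, 3, 6, 7, 8, 10, 11, 13, 15, 17, 19}"
    and R' = "{1, 2, 4, 5, 6, 7, 9, 13, 15, 16, 17, 19}"
    and m = 19 and \<sigma> = 1 and k = 0 and l = 3, simplified]

theorem theorem5p3:
  shows "(\<forall>n\<ge>1.
      partition_count (pm_residues {1, 3, 4, 5, 7, 9, 11, 16, 17, 18, 19, 20} 42) n =
      partition_count (pm_residues {1, 2, 3, 7, 8, 11, 13, 15, 17, 18, 19, 20} 42) (n - 1)) \<and>
    (\<forall>n. n \<noteq> 2 \<longrightarrow>
      partition_count (pm_residues {1, 2, 5, 6, 7, 9, 10, 11, 13, 15, 16, 19} 42) n =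
      partition_count (pm_residues {1, 3, 4, 5, 6, 7, 11, 13, 15, 16, 17, 20} 42) n) \<and>
    (\<forall>n. n \<noteq> 2 \<longrightarrow>
      partition_count (pm_residues {1, 3, 4, 5, 7, 9, 10, 11, 12, 17, 19, 20} 42) n =
      partition_count (pm_residues {1, 2, 5, 7, 8, 9, 10, 11, 12, 13, 15, 19} 42) n) \<and>
    (\<forall>n\<ge>2.
      partition_count (pm_residues {2, 3, 5, 7, 8, 9, 10, 11, 13, 17, 18, 19} 42) n =
      partition_count (pm_residues {1, 3, 5, 7, 8, 11, 13, 15, 16, 17, 18, 20} 42) (n - 2)) \<and>
    (\<forall>n\<ge>3.
      partition_count (pm_residues {3, 4, 5, 7, 8, 9, 10, 11, 12, 13, 17, 19} 42) n =
      partition_count (pm_residues {1, 4, 5, 7, 9, 12, 13, 15, 16, 17, 19, 20} 42) (n - 3)) \<and>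
    (\<forall>n. n \<noteq> 3 \<longrightarrow>
      partition_count (pm_residues {1, 2, 4, 5, 6, 7, 9, 13, 15, 16, 17, 19} 42) n =
      partition_count (pm_residues {1, 2, 3, 6, 7, 8, 10, 11, 13, 15, 17, 19} 42) n)"
  \<comment> \<open>The exceptional index \<open>l\<close> is 0 and lies outside the range
    \<open>n \<ge> k\<close> in parts (i), (iv), (v); in the other parts \<open>k = 0\<close>, and
    \<open>l\<close> is the excluded value of \<open>n\<close>.\<close>
  by (auto simp: partition_identity_1 partition_identity_5 partition_identity_11
      partition_identity_13 partition_identity_17 partition_identity_19)

end
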